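(* Let $(X,\Sigma,\mu)$ be a standard non-atomic probability space and let $\mathcal M$ be the space of mixing transformations of $(X,\Sigma,\mu)$, equipped with the leash-topology. Then for every mixing transformation $S\in\mathcal M$ the conjugacy class of $S$, that is, the set of all transformations $Q^{-1}SQ$ where $Q\colon X\to X$ is an invertible measure-preserving transformation, is dense in $\mathcal M$.
   Context: A standard non-atomic probability space is a probability space isomorphic mod $0$ to the unit interval with Lebesgue measure. Transformations (and sets, and other relations) are identified if they differ only on a set of measure zero. An invertible measure-preserving transformation $T$ of $(X,\Sigma,\mu)$ is called mixing if $\lim_{n\to\infty}\mu(T^nA\cap B)=\mu(A)\mu(B)$ for all measurable sets $A,B$. $\mathcal M$ denotes the set of all mixing transformations of $(X,\Sigma,\mu)$. The leash-topology on $\mathcal M$ is the topology having as a base the sets $$\mathcal U(T,q,\varepsilon)=\{S\in\mathcal M\mid \forall n\in\mathbb Z\ \forall A,B\in q\ \ |\mu(T^nA\cap B)-\mu(S^nA\cap B)|<\varepsilon\},$$ where $T\in\mathcal M$, $q$ is a finite collection of measurable subsets of $X$, and $\varepsilon>0$. *)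

theory Defs
  imports "HOL-Probability.Probability"
begin

definition measure_iso :: "'a measure \<Rightarrow> 'b measure \<Rightarrow> ('a \<Rightarrow> 'b) \<Rightarrow> bool" where
  "measure_iso M N f \<longleftrightarrow>
     bij_betw f (space M) (space N) \<and>
     f \<in> measurable M N \<and>
     inv_into (space M) f \<in> measurable N M \<and>
     distr M N f = N"

definition isomorphic_mod0 :: "'a measure \<Rightarrow> 'b measure \<Rightarrow> bool" where
  "isomorphic_mod0 M N \<longleftrightarrow>
     (\<exists>M0\<in>sets M. \<exists>N0\<in>sets N.
        (AE x in M. x \<in> M0) \<and> (AE y in N. y \<in> N0) \<and>
        (\<exists>f. measure_iso (restrict_space M M0) (restrict_space N N0) f))"

text \<open>The model is the unit interval with the complete Lebesgue sigma-algebra. A Borel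
  probability space is covered after passing to its completion, which changes neither the
  sets nor the transformations mod 0.\<close>

definition standard_nonatomic_prob_space :: "'a measure \<Rightarrow> bool" where
  "standard_nonatomic_prob_space M \<longleftrightarrow>
     prob_space M \<and> isomorphic_mod0 M (lebesgue_on {0..1::real})"

text \<open>Invertible measure-preserving transformations are represented by genuine bijections of
  \<^term>\<open>space M\<close>; the identification mod 0 is made by \<open>mod0\<close> below. Nothing is lost: an
  automorphism defined only mod 0 restricts to a bijection of a measurable invariant set of full
  measure, and extends by the identity to a bijection of \<^term>\<open>space M\<close>.\<close>

definition auts :: "'a measure \<Rightarrow> ('a \<Rightarrow> 'a) set" where
  "auts M = {T. measure_iso M M T}"

definition mod0 :: "'a measure \<Rightarrow> ('a \<Rightarrow> 'a) \<Rightarrow> ('a \<Rightarrow> 'a) set" where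
  "mod0 M T = {S \<in> auts M. AE x in M. S x = T x}"

definition int_iter :: "'a measure \<Rightarrow> ('a \<Rightarrow> 'a) \<Rightarrow> int \<Rightarrow> 'a \<Rightarrow> 'a" where
  "int_iter M T n =
     (if n \<ge> 0 then T ^^ nat n else inv_into (space M) T ^^ nat (- n))"

definition mixing_maps :: "'a measure \<Rightarrow> ('a \<Rightarrow> 'a) set" where
  "mixing_maps M = {T \<in> auts M. \<forall>A\<in>sets M. \<forall>B\<in>sets M.
     (\<lambda>n::nat. measure M ((T ^^ n) ` A \<inter> B)) \<longlonglongrightarrow> measure M A * measure M B}"

definition mixing_space :: "'a measure \<Rightarrow> ('a \<Rightarrow> 'a) set set" where
  "mixing_space M = mod0 M ` mixing_maps M"

definition leash_nbhd ::
  "'a measure \<Rightarrow> ('a \<Rightarrow> 'a) \<Rightarrow> 'a set set \<Rightarrow> real \<Rightarrow> ('a \<Rightarrow> 'a) set set" where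
  "leash_nbhd M T q \<epsilon> = mod0 M ` {S \<in> mixing_maps M.
     \<forall>n::int. \<forall>A\<in>q. \<forall>B\<in>q.
       \<bar>measure M (int_iter M T n ` A \<inter> B) - measure M (int_iter M S n ` A \<inter> B)\<bar> < \<epsilon>}"

definition leash_base :: "'a measure \<Rightarrow> ('a \<Rightarrow> 'a) set set set" where
  "leash_base M = {leash_nbhd M T q \<epsilon> | T q \<epsilon>.
     T \<in> mixing_maps M \<and> finite q \<and> q \<subseteq> sets M \<and> \<epsilon> > 0}"

text \<open>The open sets are the unions of members of the base; that this is a topology is
  \<open>openin_leash_topology\<close> below.\<close>

definition leash_topology :: "'a measure \<Rightarrow> ('a \<Rightarrow> 'a) set topology" where
  "leash_topology M = topology (arbitrary union_of (\<lambda>U. U \<in> leash_base M))"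

definition conj_class :: "'a measure \<Rightarrow> ('a \<Rightarrow> 'a) \<Rightarrow> ('a \<Rightarrow> 'a) set set" where
  "conj_class M S = {mod0 M (inv_into (space M) Q \<circ> S \<circ> Q) | Q. Q \<in> auts M}"


lemma auts_inv_f: "T \<in> auts M \<Longrightarrow> x \<in> space M \<Longrightarrow> inv_into (space M) T (T x) = x"
  by (auto simp: auts_def measure_iso_def bij_betw_def)

lemma auts_f_inv: "T \<in> auts M \<Longrightarrow> x \<in> space M \<Longrightarrow> T (inv_into (space M) T x) = x"
  unfolding auts_def measure_iso_def by (auto simp: bij_betw_inv_into_right)

lemma auts_measurable: "T \<in> auts M \<Longrightarrow> T \<in> measurable M M"
  by (auto simp: auts_def measure_iso_def)

lemma auts_distr: "T \<in> auts M \<Longrightarrow> distr M M T = M"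
  by (auto simp: auts_def measure_iso_def)

lemma auts_space: "T \<in> auts M \<Longrightarrow> x \<in> space M \<Longrightarrow> T x \<in> space M"
  using auts_measurable measurable_space by metis

lemma autsI:
  assumes T: "T \<in> measurable M M" and R: "R \<in> measurable M M"
    and RT: "\<And>x. x \<in> space M \<Longrightarrow> R (T x) = x" and TR: "\<And>x. x \<in> space M \<Longrightarrow> T (R x) = x"
    and d: "distr M M T = M"
  shows "T \<in> auts M"
proof -
  have sp: "T x \<in> space M" "R x \<in> space M" if "x \<in> space M" for x
    using that measurable_space[OF T] measurable_space[OF R] by auto
  have b: "bij_betw T (space M) (space M)"
    by (rule bij_betw_byWitness[of _ R]) (use RT TR sp in auto)
  have e: "inv_into (space M) T x = R x" if "x \<in> space M" for x
    using b sp TR that by (metis bij_betw_inv_into_left)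
  have "inv_into (space M) T \<in> measurable M M"
    using measurable_cong[of M "inv_into (space M) T" R M] e R by blast
  then show ?thesis
    using T b d by (auto simp: auts_def measure_iso_def)
qed

lemma auts_inv: assumes T: "T \<in> auts M" shows "inv_into (space M) T \<in> auts M"
proof -
  let ?R = "inv_into (space M) T"
  have R: "?R \<in> measurable M M"
    using T by (auto simp: auts_def measure_iso_def)
  have "distr M M ?R = distr (distr M M T) M ?R"
    by (simp add: auts_distr[OF T])
  also have "\<dots> = distr M M (?R \<circ> T)"
    by (rule distr_distr[OF R auts_measurable[OF T]])
  also have "\<dots> = distr M M (\<lambda>x. x)"
    by (rule distr_cong) (auto simp: auts_inv_f[OF T])
  finally have d: "distr M M ?R = M" by simp
  show ?thesis
    by (rule autsI[where R = T]) (use R T d auts_measurable auts_inv_f auts_f_inv in auto)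
qed

lemma auts_comp: assumes T: "T \<in> auts M" and S: "S \<in> auts M" shows "T \<circ> S \<in> auts M"
proof -
  let ?R = "inv_into (space M) S \<circ> inv_into (space M) T"
  have "distr M M (T \<circ> S) = distr (distr M M S) M T"
    using distr_distr[OF auts_measurable[OF T] auts_measurable[OF S]] by simp
  also have "\<dots> = M" by (simp add: auts_distr T S)
  finally have d: "distr M M (T \<circ> S) = M" .
  show ?thesis
  proof (rule autsI[where R = ?R])
    show "T \<circ> S \<in> measurable M M"
      by (rule measurable_comp[OF auts_measurable[OF S] auts_measurable[OF T]])
    show "?R \<in> measurable M M"
      by (rule measurable_comp[OF auts_measurable[OF auts_inv[OF T]] auts_measurable[OF auts_inv[OF S]]])
  qed (use d in \<open>simp_all add: auts_inv_f auts_f_inv auts_space auts_inv T S\<close>)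
qed

lemma auts_id: "(\<lambda>x. x) \<in> auts M"
  by (rule autsI[where R = "\<lambda>x. x"]) auto

lemma auts_funpow: "T \<in> auts M \<Longrightarrow> T ^^ n \<in> auts M"
  by (induction n) (auto intro: auts_comp auts_id[unfolded id_def[symmetric]])

lemma auts_int_iter: "T \<in> auts M \<Longrightarrow> int_iter M T n \<in> auts M"
  by (auto simp: int_iter_def auts_funpow auts_inv)

lemma funpow_inverse:
  assumes T: "T \<in> auts M" and R: "R \<in> auts M"
    and RT: "\<And>x. x \<in> space M \<Longrightarrow> R (T x) = x" and x: "x \<in> space M"
  shows "(R ^^ n) ((T ^^ n) x) = x"
  using x
proof (induction n arbitrary: x)
  case (Suc n)
  have "(R ^^ Suc n) ((T ^^ Suc n) x) = (R ^^ n) (R (T ((T ^^ n) x)))"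
    by (simp add: funpow_swap1)
  also have "\<dots> = x"
    using Suc RT auts_space[OF auts_funpow[OF T]] by simp
  finally show ?case .
qed simp

lemma int_iter_minus:
  assumes T: "T \<in> auts M" and x: "x \<in> space M"
  shows "int_iter M T (- n) (int_iter M T n x) = x"
  using funpow_inverse[OF T auts_inv[OF T] auts_inv_f[OF T] x, of "nat n"]
    funpow_inverse[OF auts_inv[OF T] T auts_f_inv[OF T] x, of "nat (- n)"]
  by (auto simp: int_iter_def)

lemma int_iter_image:
  assumes T: "T \<in> auts M" and A: "A \<in> sets M"
  shows "int_iter M T n ` A = int_iter M T (- n) -` A \<inter> space M"
proof safe
  fix x assume x: "x \<in> A"
  then have "x \<in> space M" using A sets.sets_into_space by blast
  then show "int_iter M T n x \<in> int_iter M T (- n) -` A" "int_iter M T n x \<in> space M"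
    using int_iter_minus[OF T] x auts_space[OF auts_int_iter[OF T]] by auto
next
  fix x assume x: "int_iter M T (- n) x \<in> A" "x \<in> space M"
  then show "x \<in> int_iter M T n ` A"
    using int_iter_minus[OF T, of x "- n"] by force
qed

lemma int_iter_image_sets:
  assumes T: "T \<in> auts M" and A: "A \<in> sets M"
  shows "int_iter M T n ` A \<in> sets M"
  unfolding int_iter_image[OF assms]
  by (rule measurable_sets[OF auts_measurable[OF auts_int_iter[OF T]] A])

lemma measure_int_iter_image:
  assumes T: "T \<in> auts M" and A: "A \<in> sets M"
  shows "measure M (int_iter M T n ` A) = measure M A"
  unfolding int_iter_image[OF assms]
  using measure_distr[OF auts_measurable[OF auts_int_iter[OF T]] A, of "- n"]
  by (simp add: auts_distr auts_int_iter T)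

lemma AE_auts:
  assumes T: "T \<in> auts M" and P: "AE x in M. P x" shows "AE x in M. P (T x)"
proof (rule AE_distrD[OF auts_measurable[OF T]])
  show "AE x in distr M M T. P x" unfolding auts_distr[OF T] by (rule P)
qed

lemma AE_funpow_eq:
  assumes T: "T \<in> auts M" and S: "S \<in> auts M" and e: "AE x in M. T x = S x"
  shows "AE x in M. (T ^^ n) x = (S ^^ n) x"
proof (induction n)
  case (Suc n)
  have "AE x in M. T ((S ^^ n) x) = S ((S ^^ n) x)"
    by (rule AE_auts[OF auts_funpow[OF S] e])
  with Suc show ?case by eventually_elim simp
qed simp

lemma AE_int_iter_eq:
  assumes T: "T \<in> auts M" and S: "S \<in> auts M" and e: "AE x in M. T x = S x"
  shows "AE x in M. int_iter M T n x = int_iter M S n x"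
proof -
  have "AE x in M. T (inv_into (space M) S x) = S (inv_into (space M) S x)"
    by (rule AE_auts[OF auts_inv[OF S] e])
  then have i: "AE x in M. inv_into (space M) T x = inv_into (space M) S x"
  proof (rule AE_mp, intro AE_I2 impI)
    fix x assume "x \<in> space M" "T (inv_into (space M) S x) = S (inv_into (space M) S x)"
    then show "inv_into (space M) T x = inv_into (space M) S x"
      by (metis auts_f_inv[OF S] auts_inv_f[OF T] auts_space[OF auts_inv[OF S]])
  qed
  show ?thesis
    using AE_funpow_eq[OF T S e, of "nat n"]
      AE_funpow_eq[OF auts_inv[OF T] auts_inv[OF S] i, of "nat (- n)"]
    by (auto simp: int_iter_def)
qed

lemma mod0_eq_iff:
  assumes T: "T \<in> auts M" and S: "S \<in> auts M"
  shows "mod0 M T = mod0 M S \<longleftrightarrow> (AE x in M. T x = S x)"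
proof
  have "T \<in> mod0 M T" by (simp add: mod0_def T)
  moreover assume "mod0 M T = mod0 M S"
  ultimately have "T \<in> mod0 M S" by simp
  then show "AE x in M. T x = S x" by (simp add: mod0_def)
next
  assume e: "AE x in M. T x = S x"
  show "mod0 M T = mod0 M S"
    unfolding mod0_def
  proof (intro Collect_cong conj_cong refl iffI)
    fix R assume "AE x in M. R x = T x" then show "AE x in M. R x = S x"
      using e by eventually_elim simp
  next
    fix R assume "AE x in M. R x = S x" then show "AE x in M. R x = T x"
      using e by eventually_elim simp
  qed
qed

lemma measure_int_iter_cong:
  assumes T: "T \<in> auts M" and S: "S \<in> auts M" and e: "mod0 M T = mod0 M S"
    and A: "A \<in> sets M" and B: "B \<in> sets M"
  shows "measure M (int_iter M T n ` A \<inter> B) = measure M (int_iter M S n ` A \<inter> B)"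
proof (rule measure_eq_AE)
  have "AE x in M. int_iter M T (- n) x = int_iter M S (- n) x"
    using AE_int_iter_eq[OF T S] e mod0_eq_iff[OF T S] by blast
  then show "AE x in M. x \<in> int_iter M T n ` A \<inter> B \<longleftrightarrow> x \<in> int_iter M S n ` A \<inter> B"
    by eventually_elim (auto simp: int_iter_image T S A)
qed (intro sets.Int int_iter_image_sets A B T S)+

lemma measure_int_iter_swap:
  assumes T: "T \<in> auts M" and A: "A \<in> sets M" and B: "B \<in> sets M"
  shows "measure M (int_iter M T (- n) ` A \<inter> B) = measure M (int_iter M T n ` B \<inter> A)"
proof -
  have s: "int_iter M T (- n) ` A \<inter> B \<in> sets M"
    using int_iter_image_sets[OF T A] B by auto
  have "int_iter M T n ` (int_iter M T (- n) ` A \<inter> B) = int_iter M T n ` B \<inter> A"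
    unfolding int_iter_image[OF T s] int_iter_image[OF T B]
    using sets.sets_into_space[OF A] auts_space[OF auts_int_iter[OF T]]
      int_iter_minus[OF T, of _ "- n"] by (auto simp: int_iter_image[OF T A])
  then show ?thesis
    using measure_int_iter_image[OF T s, of n] by simp
qed

lemma mixing_near_limit:
  assumes T: "T \<in> mixing_maps M" and A: "A \<in> sets M" and B: "B \<in> sets M" and e: "e > 0"
  shows "\<exists>N::nat. \<forall>n::int. \<bar>n\<bar> \<ge> int N \<longrightarrow>
    \<bar>measure M (int_iter M T n ` A \<inter> B) - measure M A * measure M B\<bar> < e"
proof -
  have Ta: "T \<in> auts M" using T by (simp add: mixing_maps_def)
  have "\<exists>N. \<forall>n\<ge>N. \<bar>measure M ((T ^^ n) ` A \<inter> B) - measure M A * measure M B\<bar> < e"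
    "\<exists>N. \<forall>n\<ge>N. \<bar>measure M ((T ^^ n) ` B \<inter> A) - measure M B * measure M A\<bar> < e"
    using T A B e unfolding mixing_maps_def by (auto simp: LIMSEQ_def dist_real_def)
  then obtain N1 N2 where
    1: "\<And>n. n \<ge> N1 \<Longrightarrow> \<bar>measure M ((T ^^ n) ` A \<inter> B) - measure M A * measure M B\<bar> < e" and
    2: "\<And>n. n \<ge> N2 \<Longrightarrow> \<bar>measure M ((T ^^ n) ` B \<inter> A) - measure M B * measure M A\<bar> < e"
    by blast
  have "\<bar>measure M (int_iter M T n ` A \<inter> B) - measure M A * measure M B\<bar> < e"
    if n: "\<bar>n\<bar> \<ge> int (max N1 N2)" for n :: int
  proof (cases "n \<ge> 0")
    case True
    then show ?thesis using 1[of "nat n"] n by (simp add: int_iter_def)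
  next
    case False
    then have "nat (- n) \<ge> N2" using n by linarith
    then have "\<bar>measure M (int_iter M T (- n) ` B \<inter> A) - measure M B * measure M A\<bar> < e"
      using 2 False by (simp add: int_iter_def)
    then show ?thesis
      using measure_int_iter_swap[OF Ta A B, of "- n"]
        measure_int_iter_swap[OF Ta B A, of n] by (simp add: mult.commute)
  qed
  then show ?thesis by blast
qed

lemma leash_nbhd_self: "T \<in> mixing_maps M \<Longrightarrow> e > 0 \<Longrightarrow> mod0 M T \<in> leash_nbhd M T q e"
  by (auto simp: leash_nbhd_def)

lemma leash_nbhd_mod0_iff:
  assumes S: "S \<in> mixing_maps M" and q: "q \<subseteq> sets M"
  shows "mod0 M S \<in> leash_nbhd M T q e \<longleftrightarrow> (\<forall>n::int. \<forall>A\<in>q. \<forall>B\<in>q.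
     \<bar>measure M (int_iter M T n ` A \<inter> B) - measure M (int_iter M S n ` A \<inter> B)\<bar> < e)"
    (is "?l \<longleftrightarrow> ?r")
proof
  assume ?l
  then obtain S' where S': "S' \<in> mixing_maps M" "mod0 M S = mod0 M S'" and
    b: "\<forall>n::int. \<forall>A\<in>q. \<forall>B\<in>q.
     \<bar>measure M (int_iter M T n ` A \<inter> B) - measure M (int_iter M S' n ` A \<inter> B)\<bar> < e"
    by (auto simp: leash_nbhd_def)
  have "measure M (int_iter M S n ` A \<inter> B) = measure M (int_iter M S' n ` A \<inter> B)"
    if "A \<in> q" "B \<in> q" for A B n
    by (rule measure_int_iter_cong) (use S S' q that in \<open>auto simp: mixing_maps_def\<close>)
  with b show ?r by simp
qed (use S in \<open>auto simp: leash_nbhd_def\<close>)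

text \<open>The strict inequalities defining \<^const>\<open>leash_nbhd\<close> hold with a uniform margin, as the
  differences tend to 0 for \<open>n \<rightarrow> \<plusminus>\<infinity>\<close> when both maps are mixing.\<close>

lemma leash_nbhd_margin:
  assumes T: "T \<in> mixing_maps M" and S: "S \<in> mixing_maps M" and q: "finite q" "q \<subseteq> sets M"
    and e: "e > 0" and m: "mod0 M S \<in> leash_nbhd M T q e"
  shows "\<exists>d>0. leash_nbhd M S q d \<subseteq> leash_nbhd M T q e"
proof -
  define c where "c R n A B = measure M (int_iter M R n ` A \<inter> B)" for R n A B
  have lt: "\<bar>c T n A B - c S n A B\<bar> < e" if "A \<in> q" "B \<in> q" for n A B
    using m leash_nbhd_mod0_iff[OF S q(2)] that by (auto simp: c_def)
  have ex: "\<exists>N::nat. \<forall>n::int. \<bar>n\<bar> \<ge> int N \<longrightarrow> \<bar>c T n A B - c S n A B\<bar> < e / 2"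
    if AB: "A \<in> q" "B \<in> q" for A B
  proof -
    have s: "A \<in> sets M" "B \<in> sets M" using AB q by auto
    have e4: "e / 4 > 0" using e by simp
    obtain N1 N2 :: nat where
      1: "\<And>n. \<bar>n\<bar> \<ge> int N1 \<Longrightarrow> \<bar>c T n A B - measure M A * measure M B\<bar> < e / 4" and
      2: "\<And>n. \<bar>n\<bar> \<ge> int N2 \<Longrightarrow> \<bar>c S n A B - measure M A * measure M B\<bar> < e / 4"
      using mixing_near_limit[OF T s e4] mixing_near_limit[OF S s e4] unfolding c_def by blast
    have "\<bar>c T n A B - c S n A B\<bar> < e / 2" if "\<bar>n\<bar> \<ge> int (max N1 N2)" for n
      using 1[of n] 2[of n] that by linarith
    then show ?thesis by blast
  qed
  then obtain N :: "'a set \<Rightarrow> 'a set \<Rightarrow> nat" where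
    N: "\<And>A B n. A \<in> q \<Longrightarrow> B \<in> q \<Longrightarrow> \<bar>n\<bar> \<ge> int (N A B) \<Longrightarrow> \<bar>c T n A B - c S n A B\<bar> < e / 2"
    by metis
  define K where "K = (\<Union>A\<in>q. \<Union>B\<in>q. (\<lambda>n. \<bar>c T n A B - c S n A B\<bar>) ` {- int (N A B)..int (N A B)})"
  have fK: "finite K" using q by (auto simp: K_def)
  define h where "h = Max (insert (e / 2) K)"
  have h: "h < e"
    unfolding h_def using fK e lt by (subst Max_less_iff) (auto simp: K_def)
  have le: "\<bar>c T n A B - c S n A B\<bar> \<le> h" if AB: "A \<in> q" "B \<in> q" for n A B
  proof (cases "\<bar>n\<bar> \<ge> int (N A B)")
    case True
    then have "\<bar>c T n A B - c S n A B\<bar> \<le> e / 2" using N[OF AB] by fastforce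
    also have "e / 2 \<le> h" unfolding h_def using fK by (intro Max_ge) auto
    finally show ?thesis .
  next
    case False
    then have "n \<in> {- int (N A B)..int (N A B)}" by auto
    then have "\<bar>c T n A B - c S n A B\<bar> \<in> K" unfolding K_def using AB by blast
    then show ?thesis unfolding h_def using fK by (intro Max_ge) auto
  qed
  have "leash_nbhd M S q (e - h) \<subseteq> leash_nbhd M T q e"
  proof
    fix u assume u: "u \<in> leash_nbhd M S q (e - h)"
    then obtain R where R: "R \<in> mixing_maps M" "u = mod0 M R"
      by (auto simp: leash_nbhd_def)
    have "\<bar>c T n A B - c R n A B\<bar> < e" if AB: "A \<in> q" "B \<in> q" for n A B
    proof -
      have "\<bar>c S n A B - c R n A B\<bar> < e - h"
        using u leash_nbhd_mod0_iff[OF R(1) q(2)] AB R(2) by (auto simp: c_def)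
      then show ?thesis using le[OF AB, of n] by linarith
    qed
    then show "u \<in> leash_nbhd M T q e"
      using leash_nbhd_mod0_iff[OF R(1) q(2)] R(2) by (auto simp: c_def)
  qed
  then show ?thesis using h by (intro exI[of _ "e - h"]) auto
qed

lemma leash_nbhd_mono:
  assumes "q' \<subseteq> q" "e \<le> e'"
  shows "leash_nbhd M T q e \<subseteq> leash_nbhd M T q' e'"
  unfolding leash_nbhd_def
  by (intro image_mono Collect_mono) (use assms in \<open>meson order_less_le_trans subsetD\<close>)

lemma istopology_leash: "istopology (arbitrary union_of (\<lambda>U. U \<in> leash_base M))"
  unfolding istopology_base_eq
proof (intro allI impI, elim conjE)
  fix U V assume "U \<in> leash_base M" "V \<in> leash_base M"
  then obtain T q e T' q' e' where
    U: "U = leash_nbhd M T q e" "T \<in> mixing_maps M" "finite q" "q \<subseteq> sets M" "e > 0" and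
    V: "V = leash_nbhd M T' q' e'" "T' \<in> mixing_maps M" "finite q'" "q' \<subseteq> sets M" "e' > 0"
    by (auto simp: leash_base_def)
  show "(arbitrary union_of (\<lambda>U. U \<in> leash_base M)) (U \<inter> V)"
    unfolding arbitrary_union_of_alt
  proof
    fix u assume u: "u \<in> U \<inter> V"
    then obtain S where S: "S \<in> mixing_maps M" "u = mod0 M S"
      by (auto simp: U(1) leash_nbhd_def)
    obtain d where d: "d > 0" "leash_nbhd M S q d \<subseteq> U"
      using leash_nbhd_margin[OF U(2) S(1) U(3-5)] u S(2) U(1) by auto
    obtain d' where d': "d' > 0" "leash_nbhd M S q' d' \<subseteq> V"
      using leash_nbhd_margin[OF V(2) S(1) V(3-5)] u S(2) V(1) by auto
    let ?W = "leash_nbhd M S (q \<union> q') (min d d')"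
    have "?W \<in> leash_base M"
      unfolding leash_base_def using S(1) U V d(1) d'(1)
      by (intro CollectI exI[of _ S] exI[of _ "q \<union> q'"] exI[of _ "min d d'"]) auto
    moreover have "u \<in> ?W"
      using leash_nbhd_self[OF S(1)] d(1) d'(1) S(2) by auto
    moreover have "?W \<subseteq> U \<inter> V"
      using leash_nbhd_mono[of q "q \<union> q'" "min d d'" d M S]
        leash_nbhd_mono[of q' "q \<union> q'" "min d d'" d' M S] d d' by auto
    ultimately show "\<exists>W. W \<in> leash_base M \<and> u \<in> W \<and> W \<subseteq> U \<inter> V" by blast
  qed
qed

theorem openin_leash_topology:
  "openin (leash_topology M) = arbitrary union_of (\<lambda>U. U \<in> leash_base M)"
  unfolding leash_topology_def by (rule topology_inverse'[OF istopology_leash])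

theorem topspace_leash_topology: "topspace (leash_topology M) = mixing_space M"
proof
  show "topspace (leash_topology M) \<subseteq> mixing_space M"
    using openin_topspace[of "leash_topology M"]
    unfolding openin_leash_topology arbitrary_union_of_alt
    by (fastforce simp: leash_base_def leash_nbhd_def mixing_space_def)
  show "mixing_space M \<subseteq> topspace (leash_topology M)"
  proof
    fix u assume "u \<in> mixing_space M"
    then obtain T where T: "T \<in> mixing_maps M" "u = mod0 M T"
      by (auto simp: mixing_space_def)
    have "leash_nbhd M T {} 1 \<in> leash_base M"
      unfolding leash_base_def using T(1)
      by (intro CollectI exI[of _ T] exI[of _ "{}"] exI[of _ "1::real"]) auto
    then have "openin (leash_topology M) (leash_nbhd M T {} 1)"
      unfolding openin_leash_topology by (rule union_of_inc[rotated]) (simp add: arbitrary_def)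
    then show "u \<in> topspace (leash_topology M)"
      using leash_nbhd_self[OF T(1), of 1 "{}"] T(2) openin_subset by fastforce
  qed
qed

end

theory Submission
  imports Defs
begin

text \<open>
  Write \<open>corr T n A B\<close> for the measure of \<open>{x \<in> A. T\<^sup>n x \<in> B}\<close>. As correlations at
  time \<open>-n\<close> are correlations at time \<open>n\<close> with \<open>A\<close> and \<open>B\<close> exchanged, only \<open>n \<ge> 0\<close> matters. Let
  \<open>T\<close> and \<open>S\<close> be mixing, and let a finite partition be given as a label \<open>a\<close> with finitely many
  values. A conjugate of \<open>S\<close> near \<open>T\<close> amounts to a label \<open>g\<close>, distributed like \<open>a\<close>, whose
  correlations under \<open>S\<close> follow those of \<open>a\<close> under \<open>T\<close> uniformly in all \<open>n\<close>: an automorphism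
  \<open>Q\<close> with \<open>g \<circ> Q = a\<close> then makes \<open>Q\<^sup>-\<^sup>1 S Q\<close> close to \<open>T\<close>.

  Up to a prescribed time \<open>L\<close> this is classical (\<open>ex_label_imitating\<close>): cut the orbits of \<open>S\<close>
  at the visits to a small set, and write on each piece of orbit a random word distributed
  like the \<open>a\<close>-names of \<open>T\<close>, independently of any finite collection of sets fixed
  beforehand. The label obtained is correct up to time \<open>L\<close>, and by mixing of \<open>S\<close> it is nearly
  independent of its translates after some much later time, but nothing is known in between.

  The remedy is to spread this failure (\<open>ex_labels_bad_one_at_a_time\<close>,
  \<open>ex_label_with_close_correlations\<close>). Divide the space into \<open>J\<close> pieces of measure about
  \<open>1/J\<close> that are almost invariant during the finite time that \<open>T\<close> needs to mix \<open>a\<close>, and label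
  the pieces one after another, choosing \<open>L\<close> for each new piece beyond the time at which the
  pieces labelled so far have become nearly independent. The intervals of uncontrolled times
  of different pieces are then disjoint, so at each time at most one piece is bad, and it
  costs at most \<open>4/J\<close>, up to small terms.

  Finally the label is corrected on a small set to have the distribution of \<open>a\<close>, and \<open>Q\<close> is
  found by Hopf's greedy matching (\<open>ex_aut_transporting_label\<close>): send \<open>x\<close> to the first
  admissible \<open>S\<^sup>n x\<close> with the right label. Since \<open>S\<close> is mixing, two sets of positive measure
  with the same label value cannot both stay unmatched.
\<close>

section \<open>Correlations and mixing\<close>

definition corr :: "'a measure \<Rightarrow> ('a \<Rightarrow> 'a) \<Rightarrow> nat \<Rightarrow> 'a set \<Rightarrow> 'a set \<Rightarrow> real" where
  "corr M T n A B = measure M {x \<in> space M. x \<in> A \<and> (T ^^ n) x \<in> B}"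

definition fiber :: "'a measure \<Rightarrow> ('a \<Rightarrow> 'b) \<Rightarrow> 'b \<Rightarrow> 'a set" where
  "fiber M f i = {x \<in> space M. f x = i}"

lemma corr_0_fiber: "corr M T 0 (fiber M a i) (fiber M a i) = measure M (fiber M a i)"
  unfolding corr_def fiber_def by (intro arg_cong[where f = "measure M"]) auto

lemma measure_auts_vimage:
  assumes "T \<in> auts M" "A \<in> sets M"
  shows "measure M {x \<in> space M. T x \<in> A} = measure M A"
  using measure_distr[OF auts_measurable[OF assms(1)] assms(2)] auts_distr[OF assms(1)]
  by (simp add: vimage_def Int_def conj_commute)

lemma corr_eq_measure_image:
  assumes T: "T \<in> auts M" and A: "A \<in> sets M" and B: "B \<in> sets M"
  shows "measure M (int_iter M T (int n) ` A \<inter> B) = corr M T n A B"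
proof -
  have "measure M (int_iter M T (int n) ` A \<inter> B) = measure M (int_iter M T (- int n) ` B \<inter> A)"
    using measure_int_iter_swap[OF T B A] by simp
  also have "int_iter M T (- int n) ` B \<inter> A = {x \<in> space M. x \<in> A \<and> (T ^^ n) x \<in> B}"
    using sets.sets_into_space[OF A] int_iter_image[OF T B, of "- int n"]
    by (auto simp: int_iter_def)
  finally show ?thesis by (simp add: corr_def)
qed

lemma mixing_iff_corr:
  "T \<in> mixing_maps M \<longleftrightarrow> T \<in> auts M \<and>
    (\<forall>A\<in>sets M. \<forall>B\<in>sets M. (\<lambda>n. corr M T n A B) \<longlonglongrightarrow> measure M A * measure M B)"
proof -
  have "(T ^^ n) ` A \<inter> B = int_iter M T (int n) ` A \<inter> B" for n A B
    by (simp add: int_iter_def)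
  then show ?thesis
    unfolding mixing_maps_def using corr_eq_measure_image[of T M] by auto
qed

section \<open>Nonatomicity\<close>

locale nonatomic_prob_space = prob_space +
  assumes divisible: "\<lbrakk>A \<in> sets M; 0 \<le> t; t \<le> prob A\<rbrakk> \<Longrightarrow> \<exists>B\<in>sets M. B \<subseteq> A \<and> prob B = t"

text \<open>The isomorphism \<open>f\<close> with the interval makes \<open>s \<mapsto> \<mu>(A \<inter> {f \<le> s})\<close> 1-Lipschitz, so the
  intermediate value theorem applies to it.\<close>

lemma standard_nonatomic_imp_nonatomic:
  assumes "standard_nonatomic_prob_space M"
  shows "nonatomic_prob_space M"
proof -
  interpret prob_space M using assms by (simp add: standard_nonatomic_prob_space_def)
  let ?L = "lebesgue_on {0..1::real}"
  obtain M0 N0 f where M0: "M0 \<in> sets M" and N0: "N0 \<in> sets ?L" and ae: "AE x in M. x \<in> M0"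
    and f: "measure_iso (restrict_space M M0) (restrict_space ?L N0) f"
    using assms unfolding standard_nonatomic_prob_space_def isomorphic_mod0_def by auto
  have sub: "M0 \<subseteq> space M" using M0 sets.sets_into_space by auto
  have fm: "f \<in> restrict_space M M0 \<rightarrow>\<^sub>M restrict_space ?L N0"
    and fd: "distr (restrict_space M M0) (restrict_space ?L N0) f = restrict_space ?L N0"
    using f by (auto simp: measure_iso_def)
  have sp: "space (restrict_space M M0) = M0" using sub by (auto simp: space_restrict_space)
  have N0s: "N0 \<subseteq> {0..1}" using sets.sets_into_space[OF N0] by auto
  have f01: "f x \<in> N0" if "x \<in> M0" for x
    using measurable_space[OF fm, of x] that sub by (auto simp: space_restrict_space)
  have f_meas: "{x \<in> M0. s < f x \<and> f x \<le> s'} \<in> sets M"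
    and f_le: "prob {x \<in> M0. s < f x \<and> f x \<le> s'} \<le> s' - s" if "s \<le> s'" for s s'
  proof -
    let ?I = "{s<..s'} \<inter> N0"
    have I: "?I \<in> sets (restrict_space ?L N0)"
      using N0 N0s by (auto simp: sets_restrict_space_iff sets_restrict_space intro!: image_eqI[of _ _ "{s<..s'} \<inter> {0..1}"])
    have v: "f -` ?I \<inter> space (restrict_space M M0) = {x \<in> M0. s < f x \<and> f x \<le> s'}"
      using f01 by (auto simp: sp)
    have m: "{x \<in> M0. s < f x \<and> f x \<le> s'} \<in> sets (restrict_space M M0)"
      using measurable_sets[OF fm I] unfolding v .
    then show 1: "{x \<in> M0. s < f x \<and> f x \<le> s'} \<in> sets M"
      using M0 by (simp add: sets_restrict_space_iff)
    have "emeasure M {x \<in> M0. s < f x \<and> f x \<le> s'} = emeasure (restrict_space M M0) {x \<in> M0. s < f x \<and> f x \<le> s'}"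
      by (rule emeasure_restrict_space[symmetric]) (use M0 in auto)
    also have "\<dots> = emeasure (distr (restrict_space M M0) (restrict_space ?L N0) f) ?I"
      by (simp only: emeasure_distr[OF fm I] v)
    also have "\<dots> = emeasure ?L ?I"
      unfolding fd by (rule emeasure_restrict_space) (use N0 in auto)
    also have "\<dots> = emeasure lebesgue ?I"
      by (rule emeasure_restrict_space) (use N0s in auto)
    also have "\<dots> \<le> emeasure lebesgue {s<..s'}"
      by (rule emeasure_mono) auto
    also have "\<dots> = ennreal (s' - s)" using that by simp
    finally show "prob {x \<in> M0. s < f x \<and> f x \<le> s'} \<le> s' - s"
      using that by (simp add: emeasure_eq_measure)
  qed
  show ?thesis
  proof
    fix A t assume A: "A \<in> sets M" and t: "0 \<le> t" "t \<le> prob A"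
    define B where "B s = A \<inter> {x \<in> M0. -1 < f x \<and> f x \<le> s}" for s
    have B: "B s \<in> sets M" if "s \<ge> -1" for s unfolding B_def using A f_meas[OF that] by auto
    have B_le: "\<bar>prob (B s') - prob (B s)\<bar> \<le> s' - s" if "-1 \<le> s" "s \<le> s'" for s s'
    proof -
      have "prob (B s') \<le> prob (B s \<union> {x \<in> M0. s < f x \<and> f x \<le> s'})"
        using that B f_meas[OF that(2)] by (intro finite_measure_mono) (auto simp: B_def)
      also have "\<dots> \<le> prob (B s) + prob {x \<in> M0. s < f x \<and> f x \<le> s'}"
        using that B f_meas[OF that(2)] by (intro measure_Un_le) auto
      finally have "prob (B s') - prob (B s) \<le> s' - s" using f_le[OF that(2)] by simp
      moreover have "prob (B s) \<le> prob (B s')"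
        using that B by (intro finite_measure_mono) (auto simp: B_def)
      ultimately show ?thesis by simp
    qed
    have cont: "continuous_on {-1..1} (\<lambda>s. prob (B s))"
    proof (rule continuous_onI)
      fix x e :: real assume "x \<in> {-1..1}" "e > 0"
      then show "\<exists>d>0. \<forall>x'\<in>{-1..1}. dist x' x < d \<longrightarrow> dist (prob (B x')) (prob (B x)) \<le> e"
        using B_le[of x] B_le[of _ x]
        by (intro exI[of _ e]) (smt (verit) atLeastAtMost_iff dist_real_def)
    qed
    have "B (-1) = {}" by (auto simp: B_def)
    then have 0: "prob (B (-1)) = 0" by simp
    have "prob (B 1) = prob A"
      by (rule measure_eq_AE) (use A B ae N0s f01 in \<open>force simp: B_def\<close>)+
    then have "\<exists>s\<ge>-1. s \<le> 1 \<and> prob (B s) = t"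
      using IVT'[of "\<lambda>s. prob (B s)" "-1" t 1] cont 0 t by auto
    then show "\<exists>B\<in>sets M. B \<subseteq> A \<and> prob B = t"
      using B by (auto simp: B_def)
  qed
qed

section \<open>Labels with prescribed and independent distributions\<close>

lemma measurable_finite_range:
  fixes f :: "'a \<Rightarrow> 'b"
  assumes "finite I" "range f \<subseteq> I" "\<And>i. i \<in> I \<Longrightarrow> {x \<in> space M. f x = i} \<in> sets M"
  shows "f \<in> M \<rightarrow>\<^sub>M count_space UNIV"
proof (rule measurableI)
  fix A :: "'b set"
  have "f -` A \<inter> space M = (\<Union>i\<in>A \<inter> I. {x \<in> space M. f x = i})"
    using assms(2) by auto
  also have "\<dots> \<in> sets M" using assms by (intro sets.finite_UN) auto
  finally show "f -` A \<inter> space M \<in> sets M" .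
qed simp

lemma measurable_glue_finite_range:
  assumes b: "b \<in> M \<rightarrow>\<^sub>M count_space UNIV" and I: "finite I" "range b \<subseteq> I"
    and f: "\<And>i. i \<in> I \<Longrightarrow> f i \<in> M \<rightarrow>\<^sub>M N"
  shows "(\<lambda>x. f (b x) x) \<in> M \<rightarrow>\<^sub>M N"
  by (rule measurable_compose_countable'[where I = I])
    (use assms in \<open>auto intro!: measurable_count_space_extend[OF _ _ b] countable_finite\<close>)

lemma (in finite_measure) measure_sum_values:
  assumes [measurable]: "Measurable.pred M P" "f \<in> M \<rightarrow>\<^sub>M count_space UNIV"
    and I: "finite I" "\<And>x. x \<in> space M \<Longrightarrow> P x \<Longrightarrow> f x \<in> I"
  shows "measure M {x \<in> space M. P x} = (\<Sum>i\<in>I. measure M {x \<in> space M. P x \<and> f x = i})"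
proof -
  have "{x \<in> space M. P x} = (\<Union>i\<in>I. {x \<in> space M. P x \<and> f x = i})"
    using I by auto
  then show ?thesis
    by (simp only:) (rule finite_measure_finite_Union, use I in \<open>auto simp: disjoint_family_on_def\<close>)
qed

context nonatomic_prob_space
begin

text \<open>All weights are attained exactly, the last one because the total is right. Off \<open>A\<close> the
  label is arbitrary, but it has to take its values in \<open>W\<close> everywhere.\<close>

lemma split_with_weights:
  assumes "finite W" "W \<noteq> {}" "A \<in> sets M" "\<And>w. w \<in> W \<Longrightarrow> p w \<ge> 0" "(\<Sum>w\<in>W. p w) = prob A"
  shows "\<exists>f. f \<in> M \<rightarrow>\<^sub>M count_space UNIV \<and> range f \<subseteq> W \<and>
    (\<forall>w\<in>W. prob {x \<in> space M. x \<in> A \<and> f x = w} = p w)"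
  using assms
proof (induction W arbitrary: A rule: finite_ne_induct)
  case (singleton w)
  then show ?case
    by (intro exI[of _ "\<lambda>_. w"]) (auto simp: Int_def[symmetric] Collect_conj_eq)
next
  case (insert w W)
  have "p w \<le> prob A" using insert by (simp add: sum_nonneg flip: insert.prems(3))
  then obtain B where B[measurable]: "B \<in> sets M" and BA: "B \<subseteq> A" and pB: "prob B = p w"
    using divisible[of A "p w"] insert by auto
  have [measurable]: "A \<in> sets M" by fact
  have "prob (A - B) = (\<Sum>w\<in>W. p w)"
    using insert.prems(3) insert.hyps by (simp add: finite_measure_Diff BA pB)
  then obtain f where [measurable]: "f \<in> M \<rightarrow>\<^sub>M count_space UNIV" and fr: "range f \<subseteq> W"
    and f: "\<And>v. v \<in> W \<Longrightarrow> prob {x \<in> space M. x \<in> A - B \<and> f x = v} = p v"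
    using insert.IH[of "A - B"] insert.prems by auto
  define g where "g x = (if x \<in> B then w else f x)" for x
  have wW: "w \<notin> W" by fact
  have gw: "{x \<in> space M. x \<in> A \<and> g x = w} = B"
    using BA fr wW sets.sets_into_space[OF B] by (auto simp: g_def)
  have gv: "{x \<in> space M. x \<in> A \<and> g x = v} = {x \<in> space M. x \<in> A - B \<and> f x = v}"
    if "v \<in> W" for v
    using that wW by (auto simp: g_def)
  have "prob {x \<in> space M. x \<in> A \<and> g x = v} = p v" if "v \<in> insert w W" for v
    using that by (auto simp only: gw gv pB f)
  moreover have "range g \<subseteq> insert w W" using fr by (auto simp: g_def)
  moreover have "g \<in> M \<rightarrow>\<^sub>M count_space UNIV" unfolding g_def by measurable
  ultimately show ?case by blast
qed

text \<open>The source of randomness in the proof: divide each level set of \<open>b\<close> in the proportions of the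
  distribution of \<open>a\<close>.\<close>

lemma independent_copy:
  assumes a[measurable]: "a \<in> M \<rightarrow>\<^sub>M count_space UNIV" and W: "finite W" "range a \<subseteq> W"
    and b[measurable]: "b \<in> M \<rightarrow>\<^sub>M count_space UNIV" and U: "finite U" "range b \<subseteq> U"
  shows "\<exists>w. w \<in> M \<rightarrow>\<^sub>M count_space UNIV \<and> range w \<subseteq> W \<and>
    (\<forall>P Q. \<P>(x in M. P (b x) \<and> Q (w x)) = \<P>(x in M. P (b x)) * \<P>(x in M. Q (a x)))"
proof -
  have ne: "W \<noteq> {}" using W by auto
  have total: "(\<Sum>v\<in>W. \<P>(x in M. a x = v)) = 1"
    using measure_sum_values[of "\<lambda>_. True" a W] W prob_space by auto
  have "\<forall>u. \<exists>f. f \<in> M \<rightarrow>\<^sub>M count_space UNIV \<and> range f \<subseteq> W \<and>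
    (\<forall>v\<in>W. prob {x \<in> space M. x \<in> {x \<in> space M. b x = u} \<and> f x = v} =
      \<P>(x in M. b x = u) * \<P>(x in M. a x = v))"
  proof (rule allI, rule split_with_weights)
    fix u
    have "(\<Sum>v\<in>W. \<P>(x in M. b x = u) * \<P>(x in M. a x = v)) =
      \<P>(x in M. b x = u) * (\<Sum>v\<in>W. \<P>(x in M. a x = v))"
      by (rule sum_distrib_left[symmetric])
    then show "(\<Sum>v\<in>W. \<P>(x in M. b x = u) * \<P>(x in M. a x = v)) = \<P>(x in M. b x = u)"
      by (simp only: total mult_1_right)
  qed (use W ne in auto)
  from choice[OF this] obtain f where f_all: "\<forall>u. f u \<in> M \<rightarrow>\<^sub>M count_space UNIV \<and> range (f u) \<subseteq> W \<and>
    (\<forall>v\<in>W. prob {x \<in> space M. x \<in> {x \<in> space M. b x = u} \<and> f u x = v} =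
      \<P>(x in M. b x = u) * \<P>(x in M. a x = v))" ..
  then have f: "\<And>u. f u \<in> M \<rightarrow>\<^sub>M count_space UNIV" "\<And>u. range (f u) \<subseteq> W" by blast+
  have fp: "prob {x \<in> space M. b x = u \<and> f u x = v} = \<P>(x in M. b x = u) * \<P>(x in M. a x = v)"
    if "v \<in> W" for u v
    using f_all that by simp
  define w where "w x = f (b x) x" for x
  have w[measurable]: "w \<in> M \<rightarrow>\<^sub>M count_space UNIV"
    unfolding w_def by (rule measurable_glue_finite_range[OF b U f(1)])
  have wr: "range w \<subseteq> W" using f(2) by (auto simp: w_def)
  have wp: "\<P>(x in M. b x = u \<and> w x = v) = \<P>(x in M. b x = u) * \<P>(x in M. a x = v)"
    if "v \<in> W" for u v
    using fp[OF that, of u] by (simp add: w_def conj_commute cong: conj_cong)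
  have "\<P>(x in M. P (b x) \<and> Q (w x)) = \<P>(x in M. P (b x)) * \<P>(x in M. Q (a x))" for P Q
  proof -
    have [measurable]: "Measurable.pred M (\<lambda>x. P (b x))" "Measurable.pred M (\<lambda>x. Q (w x))"
      by (rule measurable_compose[OF b], simp, rule measurable_compose[OF w], simp)
    have [measurable]: "Measurable.pred M (\<lambda>x. Q (a x))"
      by (rule measurable_compose[OF a]) simp
    let ?U = "{u\<in>U. P u}" and ?W = "{v\<in>W. Q v}"
    have "\<P>(x in M. P (b x) \<and> Q (w x)) = (\<Sum>u\<in>?U. \<P>(x in M. (P (b x) \<and> Q (w x)) \<and> b x = u))"
      by (rule measure_sum_values) (use U in auto)
    also have "\<dots> = (\<Sum>u\<in>?U. \<P>(x in M. b x = u \<and> Q (w x)))"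
      by (intro sum.cong refl arg_cong[where f = prob]) auto
    also have "\<dots> = (\<Sum>u\<in>?U. \<Sum>v\<in>?W. \<P>(x in M. (b x = u \<and> Q (w x)) \<and> w x = v))"
      by (intro sum.cong refl measure_sum_values) (use W wr in auto)
    also have "\<dots> = (\<Sum>u\<in>?U. \<Sum>v\<in>?W. \<P>(x in M. b x = u \<and> w x = v))"
      by (intro sum.cong refl arg_cong[where f = prob]) auto
    also have "\<dots> = (\<Sum>u\<in>?U. \<P>(x in M. b x = u)) * (\<Sum>v\<in>?W. \<P>(x in M. a x = v))"
      by (simp add: wp sum_product)
    also have "(\<Sum>u\<in>?U. \<P>(x in M. b x = u)) = (\<Sum>u\<in>?U. \<P>(x in M. P (b x) \<and> b x = u))"
      by (intro sum.cong refl arg_cong[where f = prob]) auto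
    also have "\<dots> = \<P>(x in M. P (b x))"
      by (rule measure_sum_values[symmetric]) (use U in auto)
    also have "(\<Sum>v\<in>?W. \<P>(x in M. a x = v)) = (\<Sum>v\<in>?W. \<P>(x in M. Q (a x) \<and> a x = v))"
      by (intro sum.cong refl arg_cong[where f = prob]) auto
    also have "\<dots> = \<P>(x in M. Q (a x))"
      by (rule measure_sum_values[symmetric]) (use W in auto)
    finally show ?thesis .
  qed
  with w wr show ?thesis by blast
qed

end

section \<open>Copying finite-time statistics along orbits\<close>

lemma prob_auts:
  assumes "T \<in> auts M" "Measurable.pred M P"
  shows "\<P>(x in M. P (T x)) = \<P>(x in M. P x)"
proof -
  have "{x \<in> space M. P (T x)} = {x \<in> space M. T x \<in> {x \<in> space M. P x}}"
    using auts_space[OF assms(1)] by auto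
  then show ?thesis using measure_auts_vimage[OF assms(1), of "{x \<in> space M. P x}"] assms(2) by simp
qed

lemma measurable_auts_funpow: "T \<in> auts M \<Longrightarrow> T ^^ n \<in> M \<rightarrow>\<^sub>M M"
  by (intro auts_measurable auts_funpow)

lemma inv_funpow_cancel:
  assumes T: "T \<in> auts M" and x: "x \<in> space M"
  shows "(inv_into (space M) T ^^ n) ((T ^^ n) x) = x"
    and "(T ^^ n) ((inv_into (space M) T ^^ n) x) = x"
  using funpow_inverse[OF T auts_inv[OF T] auts_inv_f[OF T] x]
    funpow_inverse[OF auts_inv[OF T] T auts_f_inv[OF T] x] by auto

lemma inv_funpow_cancel_le:
  assumes T: "T \<in> auts M" and x: "x \<in> space M" and le: "k \<le> n"
  shows "(inv_into (space M) T ^^ k) ((T ^^ n) x) = (T ^^ (n - k)) x"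
    and "(inv_into (space M) T ^^ n) ((T ^^ k) x) = (inv_into (space M) T ^^ (n - k)) x"
proof -
  obtain d where n: "n = k + d" using le by (auto simp: le_iff_add)
  show "(inv_into (space M) T ^^ k) ((T ^^ n) x) = (T ^^ (n - k)) x"
    unfolding n funpow_add using inv_funpow_cancel(1)[OF T auts_space[OF auts_funpow[OF T] x]] by simp
  show "(inv_into (space M) T ^^ n) ((T ^^ k) x) = (inv_into (space M) T ^^ (n - k)) x"
    unfolding n add.commute[of k d] funpow_add using inv_funpow_cancel(1)[OF T x] by simp
qed

definition itinerary :: "('a \<Rightarrow> 'a) \<Rightarrow> ('a \<Rightarrow> 'b) \<Rightarrow> nat \<Rightarrow> 'a \<Rightarrow> 'b list" where
  "itinerary T a H x = map (\<lambda>k. a ((T ^^ k) x)) [0..<H]"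

lemma itinerary_nth: "k < H \<Longrightarrow> itinerary T a H x ! k = a ((T ^^ k) x)"
  by (simp add: itinerary_def)

lemma itinerary_finite_range:
  assumes "finite I" "range a \<subseteq> I"
  shows "finite {ws. set ws \<subseteq> I \<and> length ws = H}" "range (itinerary T a H) \<subseteq> {ws. set ws \<subseteq> I \<and> length ws = H}"
  using assms by (force simp: itinerary_def finite_lists_length_eq)+

lemma measurable_itinerary:
  assumes T: "T \<in> auts M" and a[measurable]: "a \<in> M \<rightarrow>\<^sub>M count_space UNIV"
    and I: "finite I" "range a \<subseteq> I"
  shows "itinerary T a H \<in> M \<rightarrow>\<^sub>M count_space UNIV"
proof (rule measurable_finite_range[OF itinerary_finite_range[OF I, where H = H]])
  fix ws assume "ws \<in> {ws. set ws \<subseteq> I \<and> length ws = H}"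
  then have "{x \<in> space M. itinerary T a H x = ws} = {x \<in> space M. \<forall>k\<in>{..<H}. a ((T ^^ k) x) = ws ! k}"
    by (auto simp: itinerary_def list_eq_iff_nth_eq)
  moreover have [measurable]: "T ^^ k \<in> M \<rightarrow>\<^sub>M M" for k by (rule measurable_auts_funpow[OF T])
  ultimately show "{x \<in> space M. itinerary T a H x = ws} \<in> sets M" by simp
qed

locale mixing_system = nonatomic_prob_space M for M :: "'a measure" +
  fixes S :: "'a \<Rightarrow> 'a"
  assumes S_mixing: "S \<in> mixing_maps M"
begin

abbreviation R :: "'a \<Rightarrow> 'a" where "R \<equiv> inv_into (space M) S"

lemma S_auts: "S \<in> auts M" and R_auts: "R \<in> auts M"
  using S_mixing auts_inv by (auto simp: mixing_maps_def)

lemma S_measurable[measurable]: "S ^^ n \<in> M \<rightarrow>\<^sub>M M" and R_measurable[measurable]: "R ^^ n \<in> M \<rightarrow>\<^sub>M M"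
  by (auto intro: measurable_auts_funpow S_auts R_auts)

lemma S_space: "x \<in> space M \<Longrightarrow> (S ^^ n) x \<in> space M"
  and R_space: "x \<in> space M \<Longrightarrow> (R ^^ n) x \<in> space M"
  by (auto intro: auts_space auts_funpow S_auts R_auts)

lemma prob_S: "Measurable.pred M P \<Longrightarrow> \<P>(x in M. P ((S ^^ n) x)) = \<P>(x in M. P x)"
  by (rule prob_auts[OF auts_funpow[OF S_auts]])

lemma mixing_tendsto:
  "A \<in> sets M \<Longrightarrow> B \<in> sets M \<Longrightarrow> (\<lambda>n. corr M S n A B) \<longlonglongrightarrow> prob A * prob B"
  using S_mixing by (auto simp: mixing_iff_corr)

text \<open>A set \<open>Z\<close> of points whose past avoids \<open>F\<close> altogether never meets a forward image of \<open>F\<close>, while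
  by mixing those images have asymptotically the share \<open>\<mu>(F) \<mu>(Z)\<close> of \<open>Z\<close>; hence \<open>\<mu>(Z) = 0\<close>.\<close>

lemma prob_not_visited_tendsto_0:
  assumes F[measurable]: "F \<in> sets M" and pF: "prob F > 0"
  shows "(\<lambda>K. \<P>(x in M. \<forall>k<K. (R ^^ k) x \<notin> F)) \<longlonglongrightarrow> 0"
proof -
  define Z where "Z K = {x \<in> space M. \<forall>k<K. (R ^^ k) x \<notin> F}" for K
  have Z[measurable]: "Z K \<in> sets M" for K unfolding Z_def by measurable
  have INT: "(\<Inter>K. Z K) \<in> sets M" by (rule sets.countable_INT') (use Z in auto)
  have "(\<lambda>n. corr M S n F (\<Inter>K. Z K)) \<longlonglongrightarrow> prob F * prob (\<Inter>K. Z K)"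
    by (rule mixing_tendsto[OF F INT])
  moreover have "corr M S n F (\<Inter>K. Z K) = 0" for n
  proof -
    have "(S ^^ n) x \<notin> Z (Suc n)" if "x \<in> space M" "x \<in> F" for x
      using inv_funpow_cancel(1)[OF S_auts that(1), of n] that(2) unfolding Z_def by (auto intro!: exI[of _ n])
    then have "{x \<in> space M. x \<in> F \<and> (S ^^ n) x \<in> (\<Inter>K. Z K)} = {}" by blast
    then show ?thesis unfolding corr_def by (simp only: measure_empty)
  qed
  ultimately have "(\<lambda>n::nat. 0::real) \<longlonglongrightarrow> prob F * prob (\<Inter>K. Z K)" by simp
  then have "0 = prob F * prob (\<Inter>K. Z K)" by (simp only: LIMSEQ_const_iff)
  then have "prob (\<Inter>K. Z K) = 0" using pF by simp
  moreover have "(\<lambda>K. prob (Z K)) \<longlonglongrightarrow> prob (\<Inter>K. Z K)"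
    by (rule finite_Lim_measure_decseq) (auto simp: decseq_def Z_def)
  ultimately show ?thesis by (simp add: Z_def)
qed

text \<open>The label \<open>f\<close> imitates \<open>a\<close> for \<open>L\<close> steps, and does so independently of all the sets in \<open>\<V>\<close>. Take
  a set \<open>F\<close> of small measure and let the age of \<open>x\<close> be the time since its orbit last visited
  \<open>F\<close>. Every point of \<open>F\<close> receives an \<open>a\<close>-name \<open>w\<close> of \<open>T\<close>, independent of the \<open>S\<close>-itinerary
  with respect to \<open>\<V>\<close> and \<open>F\<close>; the label of a point of age \<open>k\<close> is the \<open>k\<close>-th letter of the
  name given to the last visit. Unless the orbit meets \<open>F\<close> again within \<open>n\<close> steps, the labels
  of \<open>x\<close> and \<open>S\<^sup>n x\<close> are the letters \<open>k\<close> and \<open>k + n\<close> of the same name, and as \<open>T\<close> preserves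
  the measure their joint distribution does not depend on \<open>k\<close>. The names are independent of the
  return times as well, which is why pieces of orbit of different lengths can be used.\<close>

lemma ex_label_imitating:
  assumes T: "T \<in> auts M" and a[measurable]: "a \<in> M \<rightarrow>\<^sub>M count_space UNIV"
    and I: "finite I" "range a \<subseteq> I"
    and V: "finite \<V>" "\<V> \<subseteq> sets M" and e: "e > 0"
  shows "\<exists>f. f \<in> M \<rightarrow>\<^sub>M count_space UNIV \<and> range f \<subseteq> I \<and>
    (\<forall>V\<in>\<V>. \<forall>n\<le>L. \<forall>i j.
      \<bar>\<P>(x in M. x \<in> V \<and> f x = i \<and> f ((S ^^ n) x) = j)
        - prob V * corr M T n (fiber M a i) (fiber M a j)\<bar> \<le> e)"
proof -
  define t where "t = min 1 (e / (2 * (real L + 1)))"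
  have t: "0 < t" "t \<le> 1" "real L * t \<le> e / 2"
  proof -
    have "real L * t \<le> (real L + 1) * (e / (2 * (real L + 1)))"
      using e by (intro mult_mono) (auto simp: t_def)
    also have "\<dots> = e / 2" by (simp add: field_simps)
    finally show "real L * t \<le> e / 2" .
  qed (use e in \<open>auto simp: t_def\<close>)
  obtain F where F[measurable]: "F \<in> sets M" and pF: "prob F = t"
    using divisible[of "space M" t] t by (auto simp: prob_space)
  have "eventually (\<lambda>K. \<P>(x in M. \<forall>k<K. (R ^^ k) x \<notin> F) < e / 2) sequentially"
    by (rule order_tendstoD(2)[OF prob_not_visited_tendsto_0]) (use pF t e in auto)
  then obtain K where K: "\<P>(x in M. \<forall>k<K. (R ^^ k) x \<notin> F) < e / 2"
    by (auto simp: eventually_sequentially)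
  \<comment> \<open>Long enough for the letters \<open>k\<close> and \<open>k + n\<close>, where \<open>k < K\<close> is an age and \<open>n \<le> L\<close>.\<close>
  define H where "H = Suc (K + L)"
  define c where "c x = ({V\<in>\<V>. x \<in> V}, x \<in> F)" for x
  have cr: "finite (Pow \<V> \<times> (UNIV :: bool set))" "range c \<subseteq> Pow \<V> \<times> UNIV"
    using V by (auto simp: c_def)
  have c[measurable]: "c \<in> M \<rightarrow>\<^sub>M count_space UNIV"
  proof (rule measurable_finite_range[OF cr])
    fix u :: "'a set set \<times> bool" assume "u \<in> Pow \<V> \<times> UNIV"
    then obtain W b where u: "u = (W, b)" "W \<subseteq> \<V>" by auto
    have "{x \<in> space M. c x = u} = {x \<in> space M. (\<forall>V\<in>\<V>. x \<in> V \<longleftrightarrow> V \<in> W) \<and> (x \<in> F \<longleftrightarrow> b)}"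
      using u by (auto simp: c_def)
    also have "\<dots> \<in> sets M"
      using V by (intro sets.sets_Collect_conj sets.sets_Collect_finite_All) auto
    finally show "{x \<in> space M. c x = u} \<in> sets M" .
  qed
  note cH = measurable_itinerary[OF S_auts c cr, of H]
    and aH = measurable_itinerary[OF T a I, of H]
  obtain w where w[measurable]: "w \<in> M \<rightarrow>\<^sub>M count_space UNIV"
    and wr: "range w \<subseteq> {ws. set ws \<subseteq> I \<and> length ws = H}"
    and indep: "\<And>P Q. \<P>(x in M. P (itinerary S c H x) \<and> Q (w x)) =
      \<P>(x in M. P (itinerary S c H x)) * \<P>(x in M. Q (itinerary T a H x))"
    using independent_copy[OF aH itinerary_finite_range[OF I] cH itinerary_finite_range[OF cr]]
    by blast
  define age where "age x = (LEAST k. (R ^^ k) x \<in> F)" for x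
  \<comment> \<open>Old points are rare; \<open>a undefined\<close> is merely some element of \<open>I\<close>.\<close>
  define f where "f x = (if \<exists>k<H. (R ^^ k) x \<in> F then w ((R ^^ age x) x) ! age x else a undefined)" for x
  have age_meas[measurable]: "age \<in> M \<rightarrow>\<^sub>M count_space UNIV" unfolding age_def by measurable
  have age_eq: "age x = k" if "(R ^^ k) x \<in> F" "\<And>l. l < k \<Longrightarrow> (R ^^ l) x \<notin> F" for x k
    unfolding age_def using that by (intro Least_equality) (auto simp: not_less[symmetric])
  have [measurable]: "(\<lambda>x. w ((R ^^ k) x) ! l) \<in> M \<rightarrow>\<^sub>M count_space UNIV" for k l
    by (rule measurable_compose[of "\<lambda>x. w ((R ^^ k) x)" M "count_space UNIV"]) auto
  have "(\<lambda>x. w ((R ^^ age x) x) ! age x) \<in> M \<rightarrow>\<^sub>M count_space UNIV"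
    by (rule measurable_compose_countable[where f = "\<lambda>k x. w ((R ^^ k) x) ! k"]) auto
  then have f[measurable]: "f \<in> M \<rightarrow>\<^sub>M count_space UNIV" unfolding f_def by measurable
  have "f x \<in> I" for x
  proof (cases "\<exists>k<H. (R ^^ k) x \<in> F")
    case True
    then have "age x < H" unfolding age_def by (meson Least_le le_less_trans)
    moreover have "set (w ((R ^^ age x) x)) \<subseteq> I" "length (w ((R ^^ age x) x)) = H"
      using wr by blast+
    ultimately show ?thesis using True nth_mem[of "age x" "w ((R ^^ age x) x)"] by (auto simp: f_def)
  next
    case False
    then show ?thesis using I(2) by (auto simp: f_def)
  qed
  then have fr: "range f \<subseteq> I" by auto
  have "\<bar>\<P>(x in M. x \<in> V \<and> f x = i \<and> f ((S ^^ n) x) = j)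
        - prob V * corr M T n (fiber M a i) (fiber M a j)\<bar> \<le> e"
    if VV: "V \<in> \<V>" and n: "n \<le> L" for V n i j
  proof -
    have Vs[measurable]: "V \<in> sets M" using VV V by auto
    \<comment> \<open>The points of age \<open>k\<close> whose orbit does not return to \<open>F\<close> within \<open>n\<close> steps.\<close>
    define G where "G k x \<longleftrightarrow> (R ^^ k) x \<in> F \<and> (\<forall>l<k. (R ^^ l) x \<notin> F) \<and> (\<forall>m\<in>{1..n}. (S ^^ m) x \<notin> F)" for k x
    have G[measurable]: "Measurable.pred M (G k)" for k unfolding G_def by measurable
    have f_on_G: "f x = w ((R ^^ k) x) ! k" "f ((S ^^ n) x) = w ((R ^^ k) x) ! (k + n)"
      if "G k x" "k < K" "x \<in> space M" for k x
    proof -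
      have 1: "(R ^^ k) x \<in> F" "\<And>l. l < k \<Longrightarrow> (R ^^ l) x \<notin> F" "\<And>m. m \<in> {1..n} \<Longrightarrow> (S ^^ m) x \<notin> F"
        using that by (auto simp: G_def)
      have "age x = k" using 1 by (intro age_eq) auto
      moreover have "k < H" using that by (simp add: H_def)
      ultimately show "f x = w ((R ^^ k) x) ! k" using 1 by (auto simp: f_def)
      have 2: "(R ^^ (k + n)) ((S ^^ n) x) = (R ^^ k) x"
        using inv_funpow_cancel_le(2)[OF S_auts that(3), of n "k + n"] by simp
      have 3: "(R ^^ l) ((S ^^ n) x) \<notin> F" if "l < k + n" for l
      proof (cases "l < n")
        case True
        then show ?thesis
          using inv_funpow_cancel_le(1)[OF S_auts \<open>x \<in> space M\<close>, of l n] 1(3)[of "n - l"] by auto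
      next
        case False
        then show ?thesis
          using inv_funpow_cancel_le(2)[OF S_auts \<open>x \<in> space M\<close>, of n l] 1(2)[of "l - n"] that by auto
      qed
      have "age ((S ^^ n) x) = k + n" using 1 2 3 by (intro age_eq) auto
      moreover have "k + n < H" using that n by (simp add: H_def)
      ultimately show "f ((S ^^ n) x) = w ((R ^^ k) x) ! (k + n)" using 1 2 by (auto simp: f_def)
    qed
    let ?c = "corr M T n (fiber M a i) (fiber M a j)"
    let ?Y = "\<lambda>x. x \<in> V \<and> f x = i \<and> f ((S ^^ n) x) = j"
    \<comment> \<open>Pull back by \<open>S\<^sup>k\<close> to the last visit, where the geometric conditions depend only on the itinerary and the labels only on \<open>w\<close>.\<close>
    have piece: "\<P>(x in M. G k x \<and> ?Y x) = \<P>(x in M. G k x \<and> x \<in> V) * ?c" if k: "k < K" for k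
    proof -
      define P where "P u \<longleftrightarrow> V \<in> fst (u ! k) \<and> snd (u ! 0) \<and> (\<forall>m\<in>{1..k + n}. \<not> snd (u ! m))"
        for u :: "('a set set \<times> bool) list"
      define Q where "Q ws \<longleftrightarrow> ws ! k = i \<and> ws ! (k + n) = j" for ws :: "'b list"
      have kn: "k + n < H" using k n by (simp add: H_def)
      have P_iff: "P (itinerary S c H y) \<longleftrightarrow> G k ((S ^^ k) y) \<and> (S ^^ k) y \<in> V" if y: "y \<in> space M" for y
      proof -
        have "P (itinerary S c H y) \<longleftrightarrow> (S ^^ k) y \<in> V \<and> y \<in> F \<and> (\<forall>m\<in>{1..k + n}. (S ^^ m) y \<notin> F)"
          using kn VV by (auto simp: P_def itinerary_nth c_def)
        also have "(\<forall>m\<in>{1..k + n}. (S ^^ m) y \<notin> F) \<longleftrightarrow>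
          (\<forall>l<k. (S ^^ (k - l)) y \<notin> F) \<and> (\<forall>m\<in>{1..n}. (S ^^ (m + k)) y \<notin> F)"
        proof (intro iffI conjI allI impI ballI)
          fix l assume "\<forall>m\<in>{1..k + n}. (S ^^ m) y \<notin> F" "l < k"
          then show "(S ^^ (k - l)) y \<notin> F" by (elim ballE[of _ _ "k - l"]) auto
        next
          fix m assume "\<forall>m\<in>{1..k + n}. (S ^^ m) y \<notin> F" "m \<in> {1..n}"
          then show "(S ^^ (m + k)) y \<notin> F" by (elim ballE[of _ _ "m + k"]) auto
        next
          fix m assume *: "(\<forall>l<k. (S ^^ (k - l)) y \<notin> F) \<and> (\<forall>m\<in>{1..n}. (S ^^ (m + k)) y \<notin> F)"
            and m: "m \<in> {1..k + n}"
          show "(S ^^ m) y \<notin> F"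
          proof (cases "m \<le> k")
            case True
            then have "k - m < k" "k - (k - m) = m" using m by auto
            then show ?thesis using * by metis
          next
            case False
            then have "m - k \<in> {1..n}" "m - k + k = m" using m by auto
            then show ?thesis using * by metis
          qed
        qed
        also have "(\<forall>m\<in>{1..n}. (S ^^ (m + k)) y \<notin> F) \<longleftrightarrow> (\<forall>m\<in>{1..n}. (S ^^ m) ((S ^^ k) y) \<notin> F)"
          by (simp add: funpow_add)
        also have "(\<forall>l<k. (S ^^ (k - l)) y \<notin> F) \<longleftrightarrow> (\<forall>l<k. (R ^^ l) ((S ^^ k) y) \<notin> F)"
          using inv_funpow_cancel_le(1)[OF S_auts y] by auto
        finally show ?thesis
          using inv_funpow_cancel(1)[OF S_auts y, of k] by (auto simp: G_def)
      qed
      have "\<P>(x in M. G k x \<and> ?Y x) = \<P>(x in M. G k x \<and> x \<in> V \<and> w ((R ^^ k) x) ! k = i \<and> w ((R ^^ k) x) ! (k + n) = j)"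
        by (intro arg_cong[where f = prob] Collect_cong) (use f_on_G k in auto)
      also have "\<dots> = \<P>(x in M. G k ((S ^^ k) x) \<and> (S ^^ k) x \<in> V \<and>
          w ((R ^^ k) ((S ^^ k) x)) ! k = i \<and> w ((R ^^ k) ((S ^^ k) x)) ! (k + n) = j)"
        by (rule prob_S[symmetric]) measurable
      also have "\<dots> = \<P>(x in M. P (itinerary S c H x) \<and> Q (w x))"
        by (intro arg_cong[where f = prob] Collect_cong)
          (auto simp: P_iff Q_def inv_funpow_cancel(1)[OF S_auts])
      also have "\<dots> = \<P>(x in M. P (itinerary S c H x)) * \<P>(x in M. Q (itinerary T a H x))"
        by (rule indep)
      also have "\<P>(x in M. P (itinerary S c H x)) = \<P>(x in M. G k ((S ^^ k) x) \<and> (S ^^ k) x \<in> V)"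
        by (intro arg_cong[where f = prob] Collect_cong) (auto simp: P_iff)
      also have "\<dots> = \<P>(x in M. G k x \<and> x \<in> V)"
        by (rule prob_S) measurable
      also have "\<P>(x in M. Q (itinerary T a H x)) = \<P>(x in M. a ((T ^^ k) x) = i \<and> a ((T ^^ n) ((T ^^ k) x)) = j)"
        using kn by (intro arg_cong[where f = prob] Collect_cong)
          (auto simp: Q_def itinerary_nth funpow_add add.commute[of k n])
      also have "\<dots> = \<P>(x in M. a x = i \<and> a ((T ^^ n) x) = j)"
      proof (rule prob_auts[OF auts_funpow[OF T]])
        have [measurable]: "T ^^ n \<in> M \<rightarrow>\<^sub>M M" by (rule measurable_auts_funpow[OF T])
        show "Measurable.pred M (\<lambda>x. a x = i \<and> a ((T ^^ n) x) = j)" by measurable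
      qed
      also have "\<dots> = ?c"
        unfolding corr_def fiber_def
        by (intro arg_cong[where f = prob] Collect_cong) (use auts_space[OF auts_funpow[OF T]] in auto)
      finally show ?thesis .
    qed
    define GG where "GG x \<longleftrightarrow> (\<exists>k<K. G k x)" for x
    have GG[measurable]: "Measurable.pred M GG" unfolding GG_def by measurable
    have G_age: "age x = k" if "G k x" for k x using that by (intro age_eq) (auto simp: G_def)
    have split: "\<P>(x in M. GG x \<and> P x) = (\<Sum>k<K. \<P>(x in M. G k x \<and> P x))"
      if [measurable]: "Measurable.pred M P" for P
    proof -
      have "\<P>(x in M. GG x \<and> P x) = (\<Sum>k<K. \<P>(x in M. (GG x \<and> P x) \<and> age x = k))"
        by (rule measure_sum_values) (use G_age in \<open>auto simp: GG_def\<close>)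
      also have "\<dots> = (\<Sum>k<K. \<P>(x in M. G k x \<and> P x))"
        by (intro sum.cong refl arg_cong[where f = prob] Collect_cong) (use G_age in \<open>auto simp: GG_def\<close>)
      finally show ?thesis .
    qed
    \<comment> \<open>An exceptional point is too old or returns to \<open>F\<close> too soon; either has probability at most \<open>e / 2\<close>.\<close>
    have rest: "\<P>(x in M. \<not> GG x) \<le> e"
    proof -
      have "\<P>(x in M. \<not> GG x) \<le> prob ({x \<in> space M. \<forall>k<K. (R ^^ k) x \<notin> F} \<union> (\<Union>m\<in>{1..n}. {x \<in> space M. (S ^^ m) x \<in> F}))"
      proof (rule finite_measure_mono)
        show "{x \<in> space M. \<not> GG x} \<subseteq> {x \<in> space M. \<forall>k<K. (R ^^ k) x \<notin> F} \<union> (\<Union>m\<in>{1..n}. {x \<in> space M. (S ^^ m) x \<in> F})"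
        proof (rule subsetI, rule ccontr)
          fix x assume x: "x \<in> {x \<in> space M. \<not> GG x}"
            and n: "x \<notin> {x \<in> space M. \<forall>k<K. (R ^^ k) x \<notin> F} \<union> (\<Union>m\<in>{1..n}. {x \<in> space M. (S ^^ m) x \<in> F})"
          then obtain k where k: "k < K" "(R ^^ k) x \<in> F" by auto
          have "G (age x) x"
            using x n k LeastI[of "\<lambda>k. (R ^^ k) x \<in> F" k] not_less_Least[of _ "\<lambda>k. (R ^^ k) x \<in> F"]
            by (auto simp: G_def age_def)
          moreover have "age x < K" using k Least_le[of "\<lambda>k. (R ^^ k) x \<in> F" k] by (simp add: age_def)
          ultimately show False using x by (auto simp: GG_def)
        qed
      qed measurable
      also have "\<dots> \<le> \<P>(x in M. \<forall>k<K. (R ^^ k) x \<notin> F) + prob (\<Union>m\<in>{1..n}. {x \<in> space M. (S ^^ m) x \<in> F})"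
        by (intro measure_Un_le) measurable
      also have "prob (\<Union>m\<in>{1..n}. {x \<in> space M. (S ^^ m) x \<in> F}) \<le> (\<Sum>m\<in>{1..n}. \<P>(x in M. (S ^^ m) x \<in> F))"
        by (intro measure_UNION_le) auto
      also have "\<dots> = real n * t" using prob_S[of "\<lambda>x. x \<in> F"] pF by (simp add: Int_absorb1 sets.sets_into_space Collect_conj_eq)
      also have "\<dots> \<le> real L * t" using n t by (intro mult_right_mono) auto
      finally show ?thesis using K t(3) by simp
    qed
    have c01: "0 \<le> ?c" "?c \<le> 1" by (auto simp: corr_def)
    have parts: "prob {x \<in> space M. P x} = \<P>(x in M. GG x \<and> P x) + \<P>(x in M. \<not> GG x \<and> P x)"
      "\<P>(x in M. \<not> GG x \<and> P x) \<in> {0..e}" if [measurable]: "Measurable.pred M P" for P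
    proof -
      have "\<P>(x in M. P x) = (\<Sum>b\<in>{True, False}. \<P>(x in M. P x \<and> GG x = b))"
        by (rule measure_sum_values) auto
      also have "\<dots> = \<P>(x in M. GG x \<and> P x) + \<P>(x in M. \<not> GG x \<and> P x)"
        by (simp add: conj_commute)
      finally show "prob {x \<in> space M. P x} = \<P>(x in M. GG x \<and> P x) + \<P>(x in M. \<not> GG x \<and> P x)" .
      have "\<P>(x in M. \<not> GG x \<and> P x) \<le> \<P>(x in M. \<not> GG x)"
        by (rule finite_measure_mono) auto
      then show "\<P>(x in M. \<not> GG x \<and> P x) \<in> {0..e}" using rest by auto
    qed
    have Vp: "prob V = \<P>(x in M. x \<in> V)"
      using sets.sets_into_space[OF Vs] by (auto intro!: arg_cong[where f = prob])
    \<comment> \<open>The errors on both sides come from the exceptional points; each lies between 0 and \<open>e\<close>, so they cannot add up.\<close>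
    have "\<P>(x in M. GG x \<and> ?Y x) = \<P>(x in M. GG x \<and> x \<in> V) * ?c"
      by (simp add: split piece sum_distrib_right)
    then have "\<P>(x in M. ?Y x) - prob V * ?c = \<P>(x in M. \<not> GG x \<and> ?Y x) - \<P>(x in M. \<not> GG x \<and> x \<in> V) * ?c"
      unfolding Vp using parts(1)[of ?Y] parts(1)[of "\<lambda>x. x \<in> V"] by (simp add: algebra_simps)
    moreover have "0 \<le> \<P>(x in M. \<not> GG x \<and> x \<in> V) * ?c" "\<P>(x in M. \<not> GG x \<and> x \<in> V) * ?c \<le> e"
      using parts(2)[of "\<lambda>x. x \<in> V"] c01 mult_left_le[of ?c "\<P>(x in M. \<not> GG x \<and> x \<in> V)"] by auto
    moreover have "\<P>(x in M. \<not> GG x \<and> ?Y x) \<in> {0..e}" by (rule parts(2)) measurable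
    ultimately show ?thesis unfolding atLeastAtMost_iff by linarith
  qed
  with f fr show ?thesis by blast
qed

end

section \<open>Gluing copies so that few of them are bad at any given time\<close>

context mixing_system
begin

lemma corr_nonneg: "0 \<le> corr M T n A B" and corr_le_1: "corr M T n A B \<le> 1"
  by (auto simp: corr_def)

lemma corr_mono:
  assumes "A \<subseteq> A'" "B \<subseteq> B'" and [measurable]: "A' \<in> sets M" "B' \<in> sets M"
  shows "corr M S n A B \<le> corr M S n A' B'"
  unfolding corr_def by (rule finite_measure_mono) (use assms in auto)

lemma corr_S_eq_R:
  assumes [measurable]: "A \<in> sets M" "B \<in> sets M"
  shows "corr M S n A B = \<P>(x in M. (R ^^ n) x \<in> A \<and> x \<in> B)"
proof -
  have "\<P>(x in M. (R ^^ n) x \<in> A \<and> x \<in> B) = \<P>(x in M. (R ^^ n) ((S ^^ n) x) \<in> A \<and> (S ^^ n) x \<in> B)"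
    by (rule prob_S[symmetric]) measurable
  also have "\<dots> = corr M S n A B"
    unfolding corr_def
    by (intro arg_cong[where f = prob] Collect_cong) (auto simp: inv_funpow_cancel(1)[OF S_auts])
  finally show ?thesis ..
qed

text \<open>The correlation of \<open>1\<^sub>A - p 1\<^sub>E\<close> with \<open>1\<^sub>B - q 1\<^sub>F\<close> at time \<open>n\<close>, expanded. In the applications
  \<open>A \<subseteq> E\<close> has nearly the proportion \<open>p\<close> of \<open>E\<close>, and likewise \<open>B \<subseteq> F\<close>, so that both functions
  have nearly mean zero. When \<open>E\<close> and \<open>F\<close> run through a partition, the terms with \<open>E\<close> in
  place of \<open>A\<close> or \<open>F\<close> in place of \<open>B\<close> sum to quantities that do not depend on \<open>n\<close>.\<close>

definition centred_corr :: "nat \<Rightarrow> 'a set \<Rightarrow> 'a set \<Rightarrow> real \<Rightarrow> 'a set \<Rightarrow> 'a set \<Rightarrow> real \<Rightarrow> real" where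
  "centred_corr n A E p B F q = corr M S n A B - q * corr M S n A F - p * corr M S n E B + p * q * corr M S n E F"

lemma abs_centred_corr_le:
  assumes "A \<subseteq> E" "B \<subseteq> F" "A \<in> sets M" "B \<in> sets M" "E \<in> sets M" "F \<in> sets M"
    and p: "0 \<le> p" "p \<le> 1" and q: "0 \<le> q" "q \<le> 1"
  shows "\<bar>centred_corr n A E p B F q\<bar> \<le> 2 * corr M S n E F"
proof -
  let ?d = "corr M S n E F"
  have d: "0 \<le> ?d" by (rule corr_nonneg)
  have le: "corr M S n A B \<le> ?d" "corr M S n A F \<le> ?d" "corr M S n E B \<le> ?d"
    using assms by (auto intro!: corr_mono)
  have "q * corr M S n A F \<le> corr M S n A F" "p * corr M S n E B \<le> corr M S n E B"
    using p q by (simp_all add: mult_left_le_one_le corr_nonneg)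
  moreover have "p * q * ?d \<le> ?d"
    using p q d by (intro mult_left_le_one_le) (auto simp: mult_le_one)
  moreover have "0 \<le> q * corr M S n A F" "0 \<le> p * corr M S n E B" "0 \<le> p * q * ?d" "0 \<le> corr M S n A B"
    using p q by (simp_all add: corr_nonneg)
  ultimately show ?thesis using le unfolding centred_corr_def by linarith
qed

lemma centred_corr_tendsto:
  assumes "A \<in> sets M" "B \<in> sets M" "E \<in> sets M" "F \<in> sets M"
  shows "(\<lambda>n. centred_corr n A E p B F q) \<longlonglongrightarrow> (prob A - p * prob E) * (prob B - q * prob F)"
proof -
  have "(\<lambda>n. centred_corr n A E p B F q) \<longlonglongrightarrow> prob A * prob B - q * (prob A * prob F) - p * (prob E * prob B)
      + p * q * (prob E * prob F)"
    unfolding centred_corr_def using assms by (intro tendsto_intros mixing_tendsto)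
  also have "prob A * prob B - q * (prob A * prob F) - p * (prob E * prob B) + p * q * (prob E * prob F)
      = (prob A - p * prob E) * (prob B - q * prob F)"
    by (simp add: algebra_simps)
  finally show ?thesis .
qed

text \<open>The label of a new piece \<open>E\<close> has to be nearly independent of all sets \<open>X\<close> already present, at
  every time up to \<open>L\<close> and in both time directions. This is \<open>ex_label_imitating\<close> applied to the sets \<open>E \<inter> S\<^sup>-\<^sup>n X\<close> and \<open>E \<inter> S\<^sup>n X\<close>.\<close>

lemma ex_label_imitating_on_piece:
  assumes T: "T \<in> auts M" and a[measurable]: "a \<in> M \<rightarrow>\<^sub>M count_space UNIV"
    and I: "finite I" "range a \<subseteq> I" and E[measurable]: "E \<in> sets M"
    and X: "finite \<X>" "\<X> \<subseteq> sets M" and e: "e > 0"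
  shows "\<exists>g. g \<in> M \<rightarrow>\<^sub>M count_space UNIV \<and> range g \<subseteq> I \<and>
    (\<forall>i. \<bar>prob (E \<inter> fiber M g i) - prob (fiber M a i) * prob E\<bar> \<le> e) \<and>
    (\<forall>n\<le>L. \<forall>i j. \<bar>corr M S n (E \<inter> fiber M g i) (E \<inter> fiber M g j)
        - corr M S n E E * corr M T n (fiber M a i) (fiber M a j)\<bar> \<le> e) \<and>
    (\<forall>X\<in>\<X>. \<forall>n\<le>L. \<forall>i.
      \<bar>corr M S n (E \<inter> fiber M g i) X - prob (fiber M a i) * corr M S n E X\<bar> \<le> e \<and>
      \<bar>corr M S n X (E \<inter> fiber M g i) - prob (fiber M a i) * corr M S n X E\<bar> \<le> e)"
proof -
  define V1 where "V1 n X = {x \<in> space M. x \<in> E \<and> (S ^^ n) x \<in> X}" for n X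
  define V2 where "V2 n X = {x \<in> space M. (R ^^ n) x \<in> X \<and> x \<in> E}" for n X
  define \<V> where "\<V> = (\<Union>n\<in>{..L}. V1 n ` insert E \<X> \<union> V2 n ` insert E \<X>) \<union> {E}"
  have V1[measurable]: "V1 n X \<in> sets M" and V2[measurable]: "V2 n X \<in> sets M" if [measurable]: "X \<in> sets M" for n X
    unfolding V1_def V2_def by measurable
  have "\<V> \<subseteq> sets M" using V1 V2 X E by (auto simp: \<V>_def)
  moreover have "finite \<V>" using X by (auto simp: \<V>_def)
  ultimately have "\<exists>g. g \<in> M \<rightarrow>\<^sub>M count_space UNIV \<and> range g \<subseteq> I \<and>
    (\<forall>V\<in>\<V>. \<forall>n\<le>L. \<forall>i j. \<bar>\<P>(x in M. x \<in> V \<and> g x = i \<and> g ((S ^^ n) x) = j)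
        - prob V * corr M T n (fiber M a i) (fiber M a j)\<bar> \<le> e)"
    by (intro ex_label_imitating T a I e)
  then obtain g where gg: "g \<in> M \<rightarrow>\<^sub>M count_space UNIV \<and> range g \<subseteq> I \<and>
    (\<forall>V\<in>\<V>. \<forall>n\<le>L. \<forall>i j. \<bar>\<P>(x in M. x \<in> V \<and> g x = i \<and> g ((S ^^ n) x) = j)
        - prob V * corr M T n (fiber M a i) (fiber M a j)\<bar> \<le> e)" ..
  note g[measurable] = gg[THEN conjunct1] and gr = gg[THEN conjunct2, THEN conjunct1]
    and g_pair = gg[THEN conjunct2, THEN conjunct2, rule_format]
  have [measurable]: "fiber M g i \<in> sets M" for i unfolding fiber_def by measurable
  have g_one: "\<bar>\<P>(x in M. x \<in> V \<and> g x = i) - prob (fiber M a i) * prob V\<bar> \<le> e" if "V \<in> \<V>" for V i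
    using g_pair[OF that, of 0 i i] by (simp add: corr_0_fiber mult.commute)
  have "\<bar>prob (E \<inter> fiber M g i) - prob (fiber M a i) * prob E\<bar> \<le> e" for i
  proof -
    have "{x \<in> space M. x \<in> E \<and> g x = i} = E \<inter> fiber M g i" by (auto simp: fiber_def)
    then show ?thesis using g_one[of E i] by (simp add: \<V>_def)
  qed
  moreover have "\<bar>corr M S n (E \<inter> fiber M g i) (E \<inter> fiber M g j)
        - corr M S n E E * corr M T n (fiber M a i) (fiber M a j)\<bar> \<le> e" if "n \<le> L" for n i j
  proof -
    have "{x \<in> space M. x \<in> V1 n E \<and> g x = i \<and> g ((S ^^ n) x) = j} =
      {x \<in> space M. x \<in> E \<inter> fiber M g i \<and> (S ^^ n) x \<in> E \<inter> fiber M g j}"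
      using S_space by (auto simp: fiber_def V1_def)
    then show ?thesis using g_pair[of "V1 n E" n i j] that by (auto simp add: \<V>_def corr_def V1_def)
  qed
  moreover have "\<bar>corr M S n (E \<inter> fiber M g i) X - prob (fiber M a i) * corr M S n E X\<bar> \<le> e"
    if "X \<in> \<X>" "n \<le> L" for X n i
  proof -
    have "{x \<in> space M. x \<in> V1 n X \<and> g x = i} = {x \<in> space M. x \<in> E \<inter> fiber M g i \<and> (S ^^ n) x \<in> X}"
      by (auto simp: fiber_def V1_def)
    then show ?thesis using g_one[of "V1 n X" i] that by (auto simp: \<V>_def corr_def V1_def)
  qed
  moreover have "\<bar>corr M S n X (E \<inter> fiber M g i) - prob (fiber M a i) * corr M S n X E\<bar> \<le> e"
    if "X \<in> \<X>" "n \<le> L" for X n i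
  proof -
    have [measurable]: "X \<in> sets M" using X that by auto
    have "{x \<in> space M. x \<in> V2 n X \<and> g x = i} = {x \<in> space M. (R ^^ n) x \<in> X \<and> x \<in> E \<inter> fiber M g i}"
      by (auto simp: fiber_def V2_def)
    then show ?thesis using g_one[of "V2 n X" i] that by (auto simp: \<V>_def corr_S_eq_R V2_def)
  qed
  ultimately show ?thesis using g gr by (intro exI[of _ g] conjI) simp_all
qed

text \<open>The step that controls all times at once. The value \<open>k0\<close> is the one piece that may be bad at time
  \<open>n\<close>; it depends on \<open>n\<close>. For the induction, mixing gives a time \<open>L\<close> after which all pairs of
  old pieces are good, and the new label is chosen to be good with all of them, and with
  itself, up to time \<open>L\<close>. Before \<open>L\<close> the bad piece is therefore the one given by
  the induction hypothesis, and from \<open>L\<close> on it is the new one.\<close>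

lemma ex_labels_bad_one_at_a_time:
  fixes e :: "'a \<Rightarrow> nat" and p :: "'b \<Rightarrow> real"
  assumes T: "T \<in> auts M" and a[measurable]: "a \<in> M \<rightarrow>\<^sub>M count_space UNIV"
    and I: "finite I" "range a \<subseteq> I" and e[measurable]: "e \<in> M \<rightarrow>\<^sub>M count_space UNIV"
    and d: "0 < d" "d \<le> 1"
    and decay: "\<And>n i j. n \<ge> N \<Longrightarrow> i \<in> I \<Longrightarrow> j \<in> I \<Longrightarrow>
      \<bar>corr M T n (fiber M a i) (fiber M a j) - prob (fiber M a i) * prob (fiber M a j)\<bar> \<le> d"
  defines "p \<equiv> \<lambda>i. prob (fiber M a i)"
  shows "\<exists>\<beta>. (\<forall>k. \<beta> k \<in> M \<rightarrow>\<^sub>M count_space UNIV \<and> range (\<beta> k) \<subseteq> I) \<and>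
    (\<forall>k<m. \<forall>i. \<bar>prob (fiber M e k \<inter> fiber M (\<beta> k) i) - p i * prob (fiber M e k)\<bar> \<le> d) \<and>
    (\<forall>k<m. \<forall>n\<le>N. \<forall>i j. \<bar>corr M S n (fiber M e k \<inter> fiber M (\<beta> k) i) (fiber M e k \<inter> fiber M (\<beta> k) j)
        - corr M S n (fiber M e k) (fiber M e k) * corr M T n (fiber M a i) (fiber M a j)\<bar> \<le> d) \<and>
    (\<forall>n\<ge>N. \<exists>k0. \<forall>k<m. \<forall>l<m. k \<noteq> k0 \<longrightarrow> l \<noteq> k0 \<longrightarrow> (\<forall>i\<in>I. \<forall>j\<in>I.
        \<bar>centred_corr n (fiber M e k \<inter> fiber M (\<beta> k) i) (fiber M e k) (p i)
               (fiber M e l \<inter> fiber M (\<beta> l) j) (fiber M e l) (p j)\<bar> \<le> 4 * d))"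
proof (induction m)
  case 0
  have "(\<lambda>_. a undefined) \<in> M \<rightarrow>\<^sub>M count_space UNIV" by simp
  then show ?case using I(2) by (intro exI[of _ "\<lambda>_ _. a undefined"]) auto
next
  case (Suc m)
  then obtain \<beta> where IH: "(\<forall>k. \<beta> k \<in> M \<rightarrow>\<^sub>M count_space UNIV \<and> range (\<beta> k) \<subseteq> I) \<and>
    (\<forall>k<m. \<forall>i. \<bar>prob (fiber M e k \<inter> fiber M (\<beta> k) i) - p i * prob (fiber M e k)\<bar> \<le> d) \<and>
    (\<forall>k<m. \<forall>n\<le>N. \<forall>i j. \<bar>corr M S n (fiber M e k \<inter> fiber M (\<beta> k) i) (fiber M e k \<inter> fiber M (\<beta> k) j)
        - corr M S n (fiber M e k) (fiber M e k) * corr M T n (fiber M a i) (fiber M a j)\<bar> \<le> d) \<and>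
    (\<forall>n\<ge>N. \<exists>k0. \<forall>k<m. \<forall>l<m. k \<noteq> k0 \<longrightarrow> l \<noteq> k0 \<longrightarrow> (\<forall>i\<in>I. \<forall>j\<in>I.
        \<bar>centred_corr n (fiber M e k \<inter> fiber M (\<beta> k) i) (fiber M e k) (p i)
               (fiber M e l \<inter> fiber M (\<beta> l) j) (fiber M e l) (p j)\<bar> \<le> 4 * d))" ..
  note \<beta>r = IH[THEN conjunct1, rule_format, THEN conjunct2]
    and \<beta>[measurable] = IH[THEN conjunct1, rule_format, THEN conjunct1]
    and one = IH[THEN conjunct2, THEN conjunct1, rule_format]
    and near = IH[THEN conjunct2, THEN conjunct2, THEN conjunct1, rule_format]
    and far = IH[THEN conjunct2, THEN conjunct2, THEN conjunct2, rule_format]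
  define E where "E k = fiber M e k" for k
  define B where "B k i = E k \<inter> fiber M (\<beta> k) i" for k i
  have E[measurable]: "E k \<in> sets M" for k unfolding E_def fiber_def by measurable
  have B[measurable]: "B k i \<in> sets M" for k i unfolding B_def fiber_def by measurable
  have "eventually (\<lambda>n. \<forall>k\<in>{..<m}. \<forall>l\<in>{..<m}. \<forall>i\<in>I. \<forall>j\<in>I.
      \<bar>centred_corr n (B k i) (E k) (p i) (B l j) (E l) (p j)\<bar> \<le> 4 * d) sequentially"
  proof (intro eventually_ball_finite finite_lessThan I(1) ballI)
    fix k l i j assume kl: "k \<in> {..<m}" "l \<in> {..<m}"
    have lim: "(\<lambda>n. \<bar>centred_corr n (B k i) (E k) (p i) (B l j) (E l) (p j)\<bar>)
      \<longlonglongrightarrow> \<bar>(prob (B k i) - p i * prob (E k)) * (prob (B l j) - p j * prob (E l))\<bar>"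
      by (intro tendsto_rabs centred_corr_tendsto B E)
    have "\<bar>(prob (B k i) - p i * prob (E k)) * (prob (B l j) - p j * prob (E l))\<bar> \<le> d * d"
      unfolding abs_mult using one kl d by (intro mult_mono) (auto simp: B_def E_def)
    also have "\<dots> \<le> d * 1" using d by (intro mult_left_mono) auto
    also have "\<dots> < 4 * d" using d by simp
    finally have "eventually (\<lambda>n. \<bar>centred_corr n (B k i) (E k) (p i) (B l j) (E l) (p j)\<bar> < 4 * d) sequentially"
      by (rule order_tendstoD(2)[OF lim])
    then show "eventually (\<lambda>n. \<bar>centred_corr n (B k i) (E k) (p i) (B l j) (E l) (p j)\<bar> \<le> 4 * d) sequentially"
      by eventually_elim simp
  qed
  then obtain L where L: "\<And>n k l i j. n \<ge> L \<Longrightarrow> k < m \<Longrightarrow> l < m \<Longrightarrow> i \<in> I \<Longrightarrow> j \<in> I \<Longrightarrow>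
      \<bar>centred_corr n (B k i) (E k) (p i) (B l j) (E l) (p j)\<bar> \<le> 4 * d"
    unfolding eventually_sequentially by (metis lessThan_iff)
  define \<X> where "\<X> = insert (E m) (E ` {..<m} \<union> (\<lambda>(k, i). B k i) ` ({..<m} \<times> I))"
  have X: "finite \<X>" "\<X> \<subseteq> sets M" using I(1) by (auto simp: \<X>_def)
  have X_mem: "E m \<in> \<X>" "\<And>k. k < m \<Longrightarrow> E k \<in> \<X>" "\<And>k i. k < m \<Longrightarrow> i \<in> I \<Longrightarrow> B k i \<in> \<X>"
    by (auto simp: \<X>_def)
  have "\<exists>g. g \<in> M \<rightarrow>\<^sub>M count_space UNIV \<and> range g \<subseteq> I \<and>
    (\<forall>i. \<bar>prob (E m \<inter> fiber M g i) - p i * prob (E m)\<bar> \<le> d) \<and>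
    (\<forall>n\<le>max L N. \<forall>i j. \<bar>corr M S n (E m \<inter> fiber M g i) (E m \<inter> fiber M g j)
        - corr M S n (E m) (E m) * corr M T n (fiber M a i) (fiber M a j)\<bar> \<le> d) \<and>
    (\<forall>X\<in>\<X>. \<forall>n\<le>max L N. \<forall>i.
      \<bar>corr M S n (E m \<inter> fiber M g i) X - p i * corr M S n (E m) X\<bar> \<le> d \<and>
      \<bar>corr M S n X (E m \<inter> fiber M g i) - p i * corr M S n X (E m)\<bar> \<le> d)"
    unfolding p_def by (intro ex_label_imitating_on_piece T a I E X d)
  then obtain g where gg: "g \<in> M \<rightarrow>\<^sub>M count_space UNIV \<and> range g \<subseteq> I \<and>
    (\<forall>i. \<bar>prob (E m \<inter> fiber M g i) - p i * prob (E m)\<bar> \<le> d) \<and>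
    (\<forall>n\<le>max L N. \<forall>i j. \<bar>corr M S n (E m \<inter> fiber M g i) (E m \<inter> fiber M g j)
        - corr M S n (E m) (E m) * corr M T n (fiber M a i) (fiber M a j)\<bar> \<le> d) \<and>
    (\<forall>X\<in>\<X>. \<forall>n\<le>max L N. \<forall>i.
      \<bar>corr M S n (E m \<inter> fiber M g i) X - p i * corr M S n (E m) X\<bar> \<le> d \<and>
      \<bar>corr M S n X (E m \<inter> fiber M g i) - p i * corr M S n X (E m)\<bar> \<le> d)" ..
  note g[measurable] = gg[THEN conjunct1] and gr = gg[THEN conjunct2, THEN conjunct1]
    and g_one = gg[THEN conjunct2, THEN conjunct2, THEN conjunct1, rule_format]
    and g_pair = gg[THEN conjunct2, THEN conjunct2, THEN conjunct2, THEN conjunct1, rule_format]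
    and g_sides = gg[THEN conjunct2, THEN conjunct2, THEN conjunct2, THEN conjunct2, rule_format]
  note g_left = g_sides[THEN conjunct1] and g_right = g_sides[THEN conjunct2]
  have p01: "0 \<le> p i" "p i \<le> 1" for i by (auto simp: p_def)
  have prod_le: "\<bar>p i * z\<bar> \<le> d" if "\<bar>z\<bar> \<le> d" for i z
    using mult_mono[of "p i" 1 "\<bar>z\<bar>" d] that p01[of i] by (simp add: abs_mult)
  define G where "G i = E m \<inter> fiber M g i" for i
  have new_new: "\<bar>centred_corr n (G i) (E m) (p i) (G j) (E m) (p j)\<bar> \<le> 4 * d"
    if n: "N \<le> n" "n \<le> L" and ij: "i \<in> I" "j \<in> I" for n i j
  proof -
    let ?v = "corr M S n (E m) (E m)" and ?c = "corr M T n (fiber M a i) (fiber M a j)"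
    have nm: "n \<le> max L N" using n by simp
    have 1: "\<bar>corr M S n (G i) (G j) - ?v * ?c\<bar> \<le> d" using g_pair[OF nm] by (simp add: G_def)
    have 2: "\<bar>p j * (corr M S n (G i) (E m) - p i * ?v)\<bar> \<le> d"
      using g_left[OF X_mem(1) nm] by (intro prod_le) (simp add: G_def)
    have 3: "\<bar>p i * (corr M S n (E m) (G j) - p j * ?v)\<bar> \<le> d"
      using g_right[OF X_mem(1) nm] by (intro prod_le) (simp add: G_def)
    \<comment> \<open>The decay of the correlations of \<open>T\<close> replaces \<open>?c\<close> by the product here.\<close>
    have "\<bar>?v * (?c - p i * p j)\<bar> \<le> 1 * d"
      unfolding abs_mult using decay[OF n(1) ij] corr_nonneg corr_le_1 d
      by (intro mult_mono) (auto simp: p_def)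
    moreover have "centred_corr n (G i) (E m) (p i) (G j) (E m) (p j) =
      (corr M S n (G i) (G j) - ?v * ?c) - p j * (corr M S n (G i) (E m) - p i * ?v)
      - p i * (corr M S n (E m) (G j) - p j * ?v) + ?v * (?c - p i * p j)"
      by (simp add: centred_corr_def algebra_simps)
    ultimately show ?thesis using 1 2 3 by linarith
  qed
  have old_new: "\<bar>centred_corr n (B k i) (E k) (p i) (G j) (E m) (p j)\<bar> \<le> 4 * d"
    if n: "n \<le> L" and "i \<in> I" "k < m" for n i j k
  proof -
    have nm: "n \<le> max L N" using n by simp
    have 1: "\<bar>corr M S n (B k i) (G j) - p j * corr M S n (B k i) (E m)\<bar> \<le> d"
      using g_right[OF X_mem(3) nm] that by (simp add: G_def)
    have 2: "\<bar>p i * (corr M S n (E k) (G j) - p j * corr M S n (E k) (E m))\<bar> \<le> d"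
      using g_right[OF X_mem(2) nm] that by (intro prod_le) (simp add: G_def)
    have "centred_corr n (B k i) (E k) (p i) (G j) (E m) (p j) =
      (corr M S n (B k i) (G j) - p j * corr M S n (B k i) (E m))
      - p i * (corr M S n (E k) (G j) - p j * corr M S n (E k) (E m))"
      by (simp add: centred_corr_def algebra_simps)
    then show ?thesis using 1 2 d by linarith
  qed
  have new_old: "\<bar>centred_corr n (G j) (E m) (p j) (B k i) (E k) (p i)\<bar> \<le> 4 * d"
    if n: "n \<le> L" and "i \<in> I" "k < m" for n i j k
  proof -
    have nm: "n \<le> max L N" using n by simp
    have 1: "\<bar>corr M S n (G j) (B k i) - p j * corr M S n (E m) (B k i)\<bar> \<le> d"
      using g_left[OF X_mem(3) nm] that by (simp add: G_def)
    have 2: "\<bar>p i * (corr M S n (G j) (E k) - p j * corr M S n (E m) (E k))\<bar> \<le> d"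
      using g_left[OF X_mem(2) nm] that by (intro prod_le) (simp add: G_def)
    have "centred_corr n (G j) (E m) (p j) (B k i) (E k) (p i) =
      (corr M S n (G j) (B k i) - p j * corr M S n (E m) (B k i))
      - p i * (corr M S n (G j) (E k) - p j * corr M S n (E m) (E k))"
      by (simp add: centred_corr_def algebra_simps)
    then show ?thesis using 1 2 d by linarith
  qed
  define \<gamma> where "\<gamma> = \<beta>(m := g)"
  have \<gamma>_old: "E k \<inter> fiber M (\<gamma> k) i = B k i" if "k < m" for k i using that by (simp add: \<gamma>_def B_def)
  have \<gamma>_new: "E m \<inter> fiber M (\<gamma> m) i = G i" for i by (simp add: \<gamma>_def G_def)
  have "\<gamma> k \<in> M \<rightarrow>\<^sub>M count_space UNIV \<and> range (\<gamma> k) \<subseteq> I" for k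
    using g gr \<beta> \<beta>r by (simp add: \<gamma>_def)
  moreover have "\<bar>prob (E k \<inter> fiber M (\<gamma> k) i) - p i * prob (E k)\<bar> \<le> d" if "k < Suc m" for k i
    using g_one[of i] one[of k i] that by (cases "k = m") (auto simp: \<gamma>_def E_def)
  moreover have "\<bar>corr M S n (E k \<inter> fiber M (\<gamma> k) i) (E k \<inter> fiber M (\<gamma> k) j)
        - corr M S n (E k) (E k) * corr M T n (fiber M a i) (fiber M a j)\<bar> \<le> d" if "k < Suc m" "n \<le> N" for k n i j
    using g_pair[of n i j] near[of k n i j] that by (cases "k = m") (auto simp: \<gamma>_def E_def)
  moreover have "\<exists>k0. \<forall>k<Suc m. \<forall>l<Suc m. k \<noteq> k0 \<longrightarrow> l \<noteq> k0 \<longrightarrow> (\<forall>i\<in>I. \<forall>j\<in>I.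
        \<bar>centred_corr n (E k \<inter> fiber M (\<gamma> k) i) (E k) (p i) (E l \<inter> fiber M (\<gamma> l) j) (E l) (p j)\<bar> \<le> 4 * d)"
    if n: "n \<ge> N" for n
  proof (cases "n \<ge> L")
    case True
    show ?thesis
    proof (intro exI[of _ m] allI impI ballI)
      fix k l i j assume "k < Suc m" "l < Suc m" "k \<noteq> m" "l \<noteq> m" "i \<in> I" "j \<in> I"
      then show "\<bar>centred_corr n (E k \<inter> fiber M (\<gamma> k) i) (E k) (p i) (E l \<inter> fiber M (\<gamma> l) j) (E l) (p j)\<bar> \<le> 4 * d"
        using L[OF True, of k l i j] by (simp add: \<gamma>_old)
    qed
  next
    case False
    then have nL: "n \<le> L" by simp
    obtain k0 where k0: "\<And>k l i j. k < m \<Longrightarrow> l < m \<Longrightarrow> k \<noteq> k0 \<Longrightarrow> l \<noteq> k0 \<Longrightarrow> i \<in> I \<Longrightarrow> j \<in> I \<Longrightarrow>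
        \<bar>centred_corr n (B k i) (E k) (p i) (B l j) (E l) (p j)\<bar> \<le> 4 * d"
      using far[OF n] unfolding B_def E_def by blast
    show ?thesis
    proof (intro exI[of _ k0] allI impI ballI)
      fix k l i j assume *: "k < Suc m" "l < Suc m" "k \<noteq> k0" "l \<noteq> k0" "i \<in> I" "j \<in> I"
      consider "k < m" "l < m" | "k = m" "l < m" | "k < m" "l = m" | "k = m" "l = m"
        using * by linarith
      then show "\<bar>centred_corr n (E k \<inter> fiber M (\<gamma> k) i) (E k) (p i) (E l \<inter> fiber M (\<gamma> l) j) (E l) (p j)\<bar> \<le> 4 * d"
      proof cases
        case 1
        then show ?thesis unfolding \<gamma>_old[OF 1(1)] \<gamma>_old[OF 1(2)] by (intro k0 *)
      next
        case 2
        then show ?thesis unfolding \<gamma>_old[OF 2(2)] unfolding 2(1) \<gamma>_new by (intro new_old nL *)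
      next
        case 3
        then show ?thesis unfolding \<gamma>_old[OF 3(1)] unfolding 3(2) \<gamma>_new by (intro old_new nL *)
      next
        case 4
        show ?thesis unfolding 4 \<gamma>_new by (intro new_new n nL *)
      qed
    qed
  qed
  ultimately show ?case unfolding E_def by (intro exI[of _ \<gamma>] conjI) simp_all
qed

end

lemma (in finite_measure) corr_split_left:
  assumes T: "T \<in> auts M" and A[measurable]: "A \<in> sets M" and B[measurable]: "B \<in> sets M"
    and e[measurable]: "e \<in> M \<rightarrow>\<^sub>M count_space UNIV" and K: "finite K" "\<And>x. x \<in> A \<Longrightarrow> e x \<in> K"
  shows "corr M T n A B = (\<Sum>k\<in>K. corr M T n (A \<inter> fiber M e k) B)"
proof -
  have [measurable]: "T ^^ n \<in> M \<rightarrow>\<^sub>M M" by (rule measurable_auts_funpow[OF T])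
  have "corr M T n A B = (\<Sum>k\<in>K. \<P>(x in M. (x \<in> A \<and> (T ^^ n) x \<in> B) \<and> e x = k))"
    unfolding corr_def by (rule measure_sum_values) (use K in auto)
  also have "\<dots> = (\<Sum>k\<in>K. corr M T n (A \<inter> fiber M e k) B)"
    unfolding corr_def fiber_def by (intro sum.cong refl arg_cong[where f = "measure M"]) auto
  finally show ?thesis .
qed

lemma (in finite_measure) corr_split_right:
  assumes T: "T \<in> auts M" and A[measurable]: "A \<in> sets M" and B[measurable]: "B \<in> sets M"
    and e[measurable]: "e \<in> M \<rightarrow>\<^sub>M count_space UNIV" and K: "finite K" "\<And>x. x \<in> B \<Longrightarrow> e x \<in> K"
  shows "corr M T n A B = (\<Sum>k\<in>K. corr M T n A (B \<inter> fiber M e k))"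
proof -
  have [measurable]: "T ^^ n \<in> M \<rightarrow>\<^sub>M M" by (rule measurable_auts_funpow[OF T])
  have "corr M T n A B = (\<Sum>k\<in>K. \<P>(x in M. (x \<in> A \<and> (T ^^ n) x \<in> B) \<and> e ((T ^^ n) x) = k))"
    unfolding corr_def by (rule measure_sum_values) (use K in auto)
  also have "\<dots> = (\<Sum>k\<in>K. corr M T n A (B \<inter> fiber M e k))"
    unfolding corr_def fiber_def
    by (intro sum.cong refl arg_cong[where f = "measure M"]) (use auts_space[OF auts_funpow[OF T]] in auto)
  finally show ?thesis .
qed

context mixing_system
begin

lemma corr_space_right: "A \<in> sets M \<Longrightarrow> corr M S n A (space M) = prob A"
  unfolding corr_def by (intro arg_cong[where f = prob]) (use sets.sets_into_space S_space in blast)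

lemma corr_space_left: "A \<in> sets M \<Longrightarrow> corr M S n (space M) A = prob A"
  unfolding corr_def using prob_S[of "\<lambda>x. x \<in> A" n] sets.sets_into_space
  by (simp add: Int_absorb1 Collect_conj_eq)

text \<open>The identity map is imitated here: a label that never changes under the identity is almost
  invariant under \<open>S\<close> for a long time.\<close>

lemma ex_slow_partition:
  assumes J: "J > (0::nat)" and d: "d > 0"
  shows "\<exists>e. e \<in> M \<rightarrow>\<^sub>M count_space UNIV \<and> range e \<subseteq> {..<J} \<and>
    (\<forall>k<J. \<forall>l<J. \<forall>n\<le>N. \<bar>corr M S n (fiber M e k) (fiber M e l) - (if k = l then 1 / J else 0)\<bar> \<le> d)"
proof -
  have "\<exists>u. u \<in> M \<rightarrow>\<^sub>M count_space UNIV \<and> range u \<subseteq> {..<J} \<and>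
    (\<forall>k\<in>{..<J}. prob {x \<in> space M. x \<in> space M \<and> u x = k} = 1 / J)"
    by (rule split_with_weights) (use J prob_space in auto)
  then obtain u where u: "u \<in> M \<rightarrow>\<^sub>M count_space UNIV" "range u \<subseteq> {..<J}"
    and up: "\<And>k. k < J \<Longrightarrow> prob {x \<in> space M. u x = k} = 1 / J"
    by auto
  have "\<exists>f. f \<in> M \<rightarrow>\<^sub>M count_space UNIV \<and> range f \<subseteq> {..<J} \<and>
    (\<forall>V\<in>{space M}. \<forall>n\<le>N. \<forall>i j. \<bar>\<P>(x in M. x \<in> V \<and> f x = i \<and> f ((S ^^ n) x) = j)
        - prob V * corr M (\<lambda>x. x) n (fiber M u i) (fiber M u j)\<bar> \<le> d)"
    by (rule ex_label_imitating[OF auts_id u(1) finite_lessThan u(2) _ _ d]) simp_all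
  then obtain e where e': "e \<in> M \<rightarrow>\<^sub>M count_space UNIV \<and> range e \<subseteq> {..<J} \<and>
    (\<forall>V\<in>{space M}. \<forall>n\<le>N. \<forall>i j. \<bar>\<P>(x in M. x \<in> V \<and> e x = i \<and> e ((S ^^ n) x) = j)
        - prob V * corr M (\<lambda>x. x) n (fiber M u i) (fiber M u j)\<bar> \<le> d)" ..
  then have e: "e \<in> M \<rightarrow>\<^sub>M count_space UNIV" "range e \<subseteq> {..<J}"
    and ep: "\<And>n i j. n \<le> N \<Longrightarrow> \<bar>\<P>(x in M. x \<in> space M \<and> e x = i \<and> e ((S ^^ n) x) = j)
        - prob (space M) * corr M (\<lambda>x. x) n (fiber M u i) (fiber M u j)\<bar> \<le> d"
    by simp_all
  have idpow: "((\<lambda>x. x) ^^ n) x = x" for n and x :: 'a by (induction n) auto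
  have "\<bar>corr M S n (fiber M e k) (fiber M e l) - (if k = l then 1 / J else 0)\<bar> \<le> d"
    if "k < J" "n \<le> N" for k l n
  proof -
    have "corr M (\<lambda>x. x) n (fiber M u k) (fiber M u l) = (if k = l then prob {x \<in> space M. u x = k} else prob {})"
      unfolding corr_def idpow fiber_def if_distrib[where f = prob, symmetric]
      by (rule arg_cong[where f = prob]) auto
    moreover have "\<P>(x in M. x \<in> space M \<and> e x = k \<and> e ((S ^^ n) x) = l) = corr M S n (fiber M e k) (fiber M e l)"
      unfolding corr_def fiber_def using S_space by (auto intro!: arg_cong[where f = prob])
    ultimately show ?thesis using ep[OF that(2), of k l] up[OF that(1)] by (simp add: prob_space split: if_splits)
  qed
  with e show ?thesis by blast
qed

text \<open>The label is glued from the labels of the pieces. Up to the time \<open>N\<close> at which \<open>T\<close> has mixed \<open>a\<close>,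
  points stay in their piece, and each piece imitates \<open>T\<close>. After \<open>N\<close>, the deviation from
  independence is the sum of the centred correlations of all pairs of pieces: the pairs of
  good pieces are negligible, and the pairs that involve the bad piece \<open>k0\<close> contribute at most
  \<open>4 \<mu>(E k0)\<close>.\<close>

lemma ex_label_with_close_correlations:
  fixes a :: "'a \<Rightarrow> 'b"
  assumes T: "T \<in> mixing_maps M" and a[measurable]: "a \<in> M \<rightarrow>\<^sub>M count_space UNIV"
    and I: "finite I" "range a \<subseteq> I" and eps: "\<epsilon> > 0"
  shows "\<exists>f. f \<in> M \<rightarrow>\<^sub>M count_space UNIV \<and> range f \<subseteq> I \<and>
    (\<forall>n. \<forall>i\<in>I. \<forall>j\<in>I. \<bar>corr M S n (fiber M f i) (fiber M f j) - corr M T n (fiber M a i) (fiber M a j)\<bar> \<le> \<epsilon>)"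
proof -
  have T_auts: "T \<in> auts M" using T by (simp add: mixing_maps_def)
  define r where "r = min \<epsilon> 1"
  have r: "0 < r" "r \<le> 1" "r \<le> \<epsilon>" using eps by (auto simp: r_def)
  obtain J :: nat where J0: "8 / r < real J" using reals_Archimedean2 by blast
  have "0 < 8 / r" using r by simp
  then have J: "0 < J" using J0 by (cases J) auto
  have J8: "1 / real J \<le> r / 8" using J0 J r by (simp add: field_simps)
  \<comment> \<open>There are \<open>J\<^sup>2\<close> pairs of pieces, each with an error of a few \<open>d\<close>.\<close>
  define d where "d = r / (32 * (real J)\<^sup>2)"
  have J1: "1 \<le> real J" using J by simp
  then have J2: "real J \<le> (real J)\<^sup>2" "1 \<le> (real J)\<^sup>2"
    by (simp_all add: self_le_power one_le_power)
  have Jd: "(real J)\<^sup>2 * d = r / 32" using J by (simp add: d_def)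
  have d: "0 < d" using r J by (simp add: d_def)
  have d_le: "d \<le> r / 32" "real J * d \<le> r / 32"
    using mult_right_mono[OF J2(1), of d] mult_right_mono[OF J2(2), of d] d Jd by auto
  have d1: "d \<le> 1" using d_le r by simp
  define p where "p i = prob (fiber M a i)" for i
  have p01: "0 \<le> p i" "p i \<le> 1" for i by (auto simp: p_def)
  have afib[measurable]: "fiber M a i \<in> sets M" for i unfolding fiber_def by measurable
  have "eventually (\<lambda>n. \<forall>i\<in>I. \<forall>j\<in>I. \<bar>corr M T n (fiber M a i) (fiber M a j) - p i * p j\<bar> < d) sequentially"
  proof (intro eventually_ball_finite I(1) ballI)
    fix i j
    have "(\<lambda>n. corr M T n (fiber M a i) (fiber M a j)) \<longlonglongrightarrow> p i * p j"
      using T afib unfolding mixing_iff_corr p_def by blast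
    from tendstoD[OF this d] show "eventually (\<lambda>n. \<bar>corr M T n (fiber M a i) (fiber M a j) - p i * p j\<bar> < d) sequentially"
      by (simp add: dist_real_def)
  qed
  then obtain N where decay: "\<And>n i j. n \<ge> N \<Longrightarrow> i \<in> I \<Longrightarrow> j \<in> I \<Longrightarrow>
      \<bar>corr M T n (fiber M a i) (fiber M a j) - p i * p j\<bar> \<le> d"
    unfolding eventually_sequentially by (meson less_imp_le)
  obtain e where e[measurable]: "e \<in> M \<rightarrow>\<^sub>M count_space UNIV" and er: "range e \<subseteq> {..<J}"
    and slow: "\<And>k l n. k < J \<Longrightarrow> l < J \<Longrightarrow> n \<le> N \<Longrightarrow>
      \<bar>corr M S n (fiber M e k) (fiber M e l) - (if k = l then 1 / J else 0)\<bar> \<le> d"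
    using ex_slow_partition[OF J d, of N] by blast
  have "\<exists>\<beta>. (\<forall>k. \<beta> k \<in> M \<rightarrow>\<^sub>M count_space UNIV \<and> range (\<beta> k) \<subseteq> I) \<and>
    (\<forall>k<J. \<forall>i. \<bar>prob (fiber M e k \<inter> fiber M (\<beta> k) i) - p i * prob (fiber M e k)\<bar> \<le> d) \<and>
    (\<forall>k<J. \<forall>n\<le>N. \<forall>i j. \<bar>corr M S n (fiber M e k \<inter> fiber M (\<beta> k) i) (fiber M e k \<inter> fiber M (\<beta> k) j)
        - corr M S n (fiber M e k) (fiber M e k) * corr M T n (fiber M a i) (fiber M a j)\<bar> \<le> d) \<and>
    (\<forall>n\<ge>N. \<exists>k0. \<forall>k<J. \<forall>l<J. k \<noteq> k0 \<longrightarrow> l \<noteq> k0 \<longrightarrow> (\<forall>i\<in>I. \<forall>j\<in>I.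
        \<bar>centred_corr n (fiber M e k \<inter> fiber M (\<beta> k) i) (fiber M e k) (p i)
               (fiber M e l \<inter> fiber M (\<beta> l) j) (fiber M e l) (p j)\<bar> \<le> 4 * d))"
    unfolding p_def using decay by (intro ex_labels_bad_one_at_a_time T_auts a I e d d1) (simp add: p_def)
  then obtain \<beta> where \<beta>': "(\<forall>k. \<beta> k \<in> M \<rightarrow>\<^sub>M count_space UNIV \<and> range (\<beta> k) \<subseteq> I) \<and>
    (\<forall>k<J. \<forall>i. \<bar>prob (fiber M e k \<inter> fiber M (\<beta> k) i) - p i * prob (fiber M e k)\<bar> \<le> d) \<and>
    (\<forall>k<J. \<forall>n\<le>N. \<forall>i j. \<bar>corr M S n (fiber M e k \<inter> fiber M (\<beta> k) i) (fiber M e k \<inter> fiber M (\<beta> k) j)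
        - corr M S n (fiber M e k) (fiber M e k) * corr M T n (fiber M a i) (fiber M a j)\<bar> \<le> d) \<and>
    (\<forall>n\<ge>N. \<exists>k0. \<forall>k<J. \<forall>l<J. k \<noteq> k0 \<longrightarrow> l \<noteq> k0 \<longrightarrow> (\<forall>i\<in>I. \<forall>j\<in>I.
        \<bar>centred_corr n (fiber M e k \<inter> fiber M (\<beta> k) i) (fiber M e k) (p i)
               (fiber M e l \<inter> fiber M (\<beta> l) j) (fiber M e l) (p j)\<bar> \<le> 4 * d))" ..
  note \<beta>r = \<beta>'[THEN conjunct1, rule_format, THEN conjunct2]
    and \<beta>[measurable] = \<beta>'[THEN conjunct1, rule_format, THEN conjunct1]
    and one = \<beta>'[THEN conjunct2, THEN conjunct1, rule_format]
    and near = \<beta>'[THEN conjunct2, THEN conjunct2, THEN conjunct1, rule_format]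
    and far = \<beta>'[THEN conjunct2, THEN conjunct2, THEN conjunct2, rule_format]
  define f where "f x = \<beta> (e x) x" for x
  have f[measurable]: "f \<in> M \<rightarrow>\<^sub>M count_space UNIV"
    unfolding f_def by (rule measurable_glue_finite_range[OF e _ er \<beta>]) simp
  have fr: "range f \<subseteq> I" using \<beta>r by (auto simp: f_def)
  define E where "E k = fiber M e k" for k
  define A where "A i = fiber M f i" for i
  define B where "B k i = E k \<inter> fiber M (\<beta> k) i" for k i
  have E[measurable]: "E k \<in> sets M" for k unfolding E_def fiber_def by measurable
  have A[measurable]: "A i \<in> sets M" for i unfolding A_def fiber_def by measurable
  have B[measurable]: "B k i \<in> sets M" for k i unfolding B_def fiber_def by measurable
  have AE: "A i \<inter> E k = B k i" for i k by (auto simp: A_def E_def B_def fiber_def f_def)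
  have XE: "space M \<inter> E k = E k" for k by (auto simp: E_def fiber_def)
  have BE: "B k i \<subseteq> E k" for k i by (auto simp: B_def)
  have split_l: "corr M S n Y Z = (\<Sum>k<J. corr M S n (Y \<inter> E k) Z)"
    and split_r: "corr M S n Y Z = (\<Sum>l<J. corr M S n Y (Z \<inter> E l))"
    if "Y \<in> sets M" "Z \<in> sets M" for n Y Z
    unfolding E_def using er
    by (auto intro!: corr_split_left[OF S_auts that e] corr_split_right[OF S_auts that e])
  have split: "corr M S n Y Z = (\<Sum>k<J. \<Sum>l<J. corr M S n (Y \<inter> E k) (Z \<inter> E l))"
    if "Y \<in> sets M" "Z \<in> sets M" for n Y Z
  proof -
    have "corr M S n Y Z = (\<Sum>k<J. corr M S n (Y \<inter> E k) Z)" by (rule split_l[OF that])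
    also have "\<dots> = (\<Sum>k<J. \<Sum>l<J. corr M S n (Y \<inter> E k) (Z \<inter> E l))"
      by (intro sum.cong refl split_r) (use that E in auto)
    finally show ?thesis .
  qed
  have prob_E: "prob (E k) \<le> r / 8 + r / 32" if "k < J" for k
  proof -
    have "corr M S 0 (E k) (E k) = prob (E k)"
      unfolding corr_def using sets.sets_into_space[OF E[of k]] by (auto intro!: arg_cong[where f = prob])
    then show ?thesis using slow[OF that that, of 0] J8 d_le(1) by (auto simp: E_def)
  qed
  have XX: "corr M S n (space M) (space M) = 1" for n
    using corr_space_right[of "space M" n] prob_space by simp
  have "\<bar>corr M S n (A i) (A j) - corr M T n (fiber M a i) (fiber M a j)\<bar> \<le> \<epsilon>"
    if ij: "i \<in> I" "j \<in> I" for n i j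
  proof (cases "n \<le> N")
    case True
    let ?c = "corr M T n (fiber M a i) (fiber M a j)"
    have c01: "0 \<le> ?c" "?c \<le> 1" by (auto simp: corr_nonneg corr_le_1)
    have term_le: "\<bar>corr M S n (B k i) (B l j) - corr M S n (E k) (E l) * ?c\<bar> \<le> d"
      if kl: "k < J" "l < J" for k l
    proof (cases "k = l")
      case True
      then show ?thesis using near[OF kl(1) \<open>n \<le> N\<close>, of i j] by (simp add: B_def E_def)
    next
      case False
      then have small: "corr M S n (E k) (E l) \<le> d"
        using slow[OF kl \<open>n \<le> N\<close>] by (auto simp: E_def)
      have "corr M S n (B k i) (B l j) \<le> corr M S n (E k) (E l)"
        by (intro corr_mono BE E)
      moreover have "corr M S n (E k) (E l) * ?c \<le> corr M S n (E k) (E l)"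
        using c01 by (intro mult_right_le_one_le corr_nonneg)
      moreover have "0 \<le> corr M S n (E k) (E l) * ?c" "0 \<le> corr M S n (B k i) (B l j)"
        using c01 by (simp_all add: corr_nonneg)
      ultimately show ?thesis using small by linarith
    qed
    have "corr M S n (A i) (A j) - ?c
      = corr M S n (A i) (A j) - corr M S n (space M) (space M) * ?c"
      by (simp add: XX)
    also have "\<dots> = (\<Sum>k<J. \<Sum>l<J. corr M S n (B k i) (B l j) - corr M S n (E k) (E l) * ?c)"
      by (subst split[OF A A], subst split[OF sets.top sets.top])
        (simp add: AE XE sum_subtractf sum_distrib_right)
    finally have "\<bar>corr M S n (A i) (A j) - ?c\<bar>
      \<le> (\<Sum>k<J. \<Sum>l<J. \<bar>corr M S n (B k i) (B l j) - corr M S n (E k) (E l) * ?c\<bar>)"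
      by (auto intro!: order_trans[OF sum_abs] sum_mono)
    also have "\<dots> \<le> (\<Sum>k<J. \<Sum>l<J. d)" by (intro sum_mono term_le) auto
    also have "\<dots> = r / 32" using Jd by (simp add: power2_eq_square)
    also have "\<dots> \<le> \<epsilon>" using r by simp
    finally show ?thesis .
  next
    case False
    then have n: "N \<le> n" by simp
    obtain k0 where k0: "\<And>k l. k < J \<Longrightarrow> l < J \<Longrightarrow> k \<noteq> k0 \<Longrightarrow> l \<noteq> k0 \<Longrightarrow>
        \<bar>centred_corr n (B k i) (E k) (p i) (B l j) (E l) (p j)\<bar> \<le> 4 * d"
      using far[OF n] ij unfolding B_def E_def by blast
    let ?D = "\<lambda>k l. centred_corr n (B k i) (E k) (p i) (B l j) (E l) (p j)"
    let ?b = "\<lambda>k l. (if k = k0 then 2 * corr M S n (E k) (E l) else 0) + (if l = k0 then 2 * corr M S n (E k) (E l) else 0)"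
    \<comment> \<open>The term \<open>?b k l\<close> is the trivial bound, charged to the row and the column of \<open>k0\<close>.\<close>
    have D_le: "\<bar>?D k l\<bar> \<le> 4 * d + ?b k l" if "k < J" "l < J" for k l
    proof (cases "k = k0 \<or> l = k0")
      case True
      have "\<bar>?D k l\<bar> \<le> 2 * corr M S n (E k) (E l)"
        by (intro abs_centred_corr_le BE B E p01)
      then show ?thesis using True d corr_nonneg[of S n "E k" "E l"] by auto
    next
      case False
      then show ?thesis using k0[OF that] by auto
    qed
    have "(\<Sum>k<J. \<Sum>l<J. ?D k l) = centred_corr n (A i) (space M) (p i) (A j) (space M) (p j)"
    proof -
      have "corr M S n (A i) (A j) = (\<Sum>k<J. \<Sum>l<J. corr M S n (B k i) (B l j))"
        "corr M S n (A i) (space M) = (\<Sum>k<J. \<Sum>l<J. corr M S n (B k i) (E l))"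
        "corr M S n (space M) (A j) = (\<Sum>k<J. \<Sum>l<J. corr M S n (E k) (B l j))"
        "corr M S n (space M) (space M) = (\<Sum>k<J. \<Sum>l<J. corr M S n (E k) (E l))"
        by (simp_all add: split[of "A i" "A j"] split[of "A i" "space M"] split[of "space M" "A j"]
          split[of "space M" "space M"] AE XE A)
      then show ?thesis
        by (simp add: centred_corr_def sum_subtractf sum.distrib sum_distrib_left)
    qed
    also have "\<dots> = corr M S n (A i) (A j) - p j * prob (A i) - p i * prob (A j) + p i * p j"
      by (simp add: centred_corr_def corr_space_left corr_space_right A XX)
    finally have expand: "corr M S n (A i) (A j) - p i * p j
      = (\<Sum>k<J. \<Sum>l<J. ?D k l) + p j * (prob (A i) - p i) + p i * (prob (A j) - p j)"
      by (simp add: algebra_simps)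
    have marg: "\<bar>prob (A i) - p i\<bar> \<le> r / 32" for i
    proof -
      have "prob (A i) - p i * prob (space M) = (\<Sum>k<J. prob (B k i) - p i * prob (E k))"
      proof -
        have "prob (A i) = (\<Sum>k<J. prob (B k i))" "prob (space M) = (\<Sum>k<J. prob (E k))"
          using split_l[of "A i" "space M" 0] split_l[of "space M" "space M" 0]
          by (simp_all add: corr_space_right A B E AE XE)
        then show ?thesis by (simp add: sum_subtractf sum_distrib_left)
      qed
      then have "\<bar>prob (A i) - p i\<bar> \<le> (\<Sum>k<J. \<bar>prob (B k i) - p i * prob (E k)\<bar>)"
        by (simp add: prob_space)
      also have "\<dots> \<le> (\<Sum>k<J. d)" using one by (intro sum_mono) (auto simp: B_def E_def)
      finally show ?thesis using d_le by simp
    qed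
    have marg_mult: "\<bar>p i * (prob (A j) - p j)\<bar> \<le> r / 32" for i j
      using mult_mono[OF p01(2)[of i] marg[of j]] p01[of i] by (simp add: abs_mult)
    have "\<bar>\<Sum>k<J. \<Sum>l<J. ?D k l\<bar> \<le> (\<Sum>k<J. \<Sum>l<J. \<bar>?D k l\<bar>)"
      by (auto intro!: order_trans[OF sum_abs] sum_mono)
    also have "\<dots> \<le> (\<Sum>k<J. \<Sum>l<J. 4 * d + ?b k l)" by (intro sum_mono D_le) auto
    also have "\<dots> = 4 * ((real J)\<^sup>2 * d) + (\<Sum>k<J. \<Sum>l<J. ?b k l)"
      by (simp add: sum.distrib power2_eq_square)
    also have "(\<Sum>k<J. \<Sum>l<J. ?b k l) = (\<Sum>k<J. if k = k0 then 2 * (\<Sum>l<J. corr M S n (E k) (E l)) else 0)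
      + (\<Sum>l<J. if l = k0 then 2 * (\<Sum>k<J. corr M S n (E k) (E l)) else 0)"
    proof -
      have "(\<Sum>k<J. \<Sum>l<J. if k = k0 then 2 * corr M S n (E k) (E l) else 0) =
        (\<Sum>k<J. if k = k0 then 2 * (\<Sum>l<J. corr M S n (E k) (E l)) else 0)"
        by (intro sum.cong refl) (simp add: sum_distrib_left)
      moreover have "(\<Sum>k<J. \<Sum>l<J. if l = k0 then 2 * corr M S n (E k) (E l) else 0) =
        (\<Sum>l<J. \<Sum>k<J. if l = k0 then 2 * corr M S n (E k) (E l) else 0)"
        by (rule sum.swap)
      moreover have "\<dots> = (\<Sum>l<J. if l = k0 then 2 * (\<Sum>k<J. corr M S n (E k) (E l)) else 0)"
        by (intro sum.cong refl) (simp add: sum_distrib_left)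
      ultimately show ?thesis by (simp only: sum.distrib)
    qed
    also have "\<dots> = (\<Sum>k<J. if k = k0 then 2 * prob (E k) else 0) + (\<Sum>l<J. if l = k0 then 2 * prob (E l) else 0)"
    proof -
      have "(\<Sum>l<J. corr M S n (E k) (E l)) = prob (E k)" "(\<Sum>l<J. corr M S n (E l) (E k)) = prob (E k)" for k
        using split_r[of "E k" "space M" n] split_l[of "space M" "E k" n]
        by (simp_all add: corr_space_right corr_space_left E XE)
      then show ?thesis by simp
    qed
    also have "\<dots> \<le> 4 * (r / 8 + r / 32)"
      using prob_E[of k0] r by (cases "k0 < J") (simp_all add: sum.delta)
    also have "4 * ((real J)\<^sup>2 * d) = r / 8" using Jd by simp
    also have "r / 8 + 4 * (r / 8 + r / 32) = 3 * r / 4" by (simp add: field_simps)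
    finally have "\<bar>\<Sum>k<J. \<Sum>l<J. ?D k l\<bar> \<le> 3 * r / 4" by simp
    moreover have "\<bar>corr M T n (fiber M a i) (fiber M a j) - p i * p j\<bar> \<le> r / 32"
      using decay[OF n ij] d_le by linarith
    moreover have "\<bar>c - t\<bar> \<le> r"
      if "\<bar>s\<bar> \<le> 3 * r / 4" "\<bar>t - q\<bar> \<le> r / 32" "c - q = s + x + y" "\<bar>x\<bar> \<le> r / 32" "\<bar>y\<bar> \<le> r / 32"
      for c q s t x y :: real
      using that r by linarith
    ultimately have "\<bar>corr M S n (A i) (A j) - corr M T n (fiber M a i) (fiber M a j)\<bar> \<le> r"
      using expand marg_mult by blast
    then show ?thesis using r by simp
  qed
  then show ?thesis using f fr unfolding A_def by (intro exI[of _ f]) auto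
qed

end

section \<open>Realising a label by an automorphism\<close>

text \<open>Greedy matching: \<open>x\<close> is matched to \<open>S\<^sup>n x\<close> at stage \<open>n\<close> if the labels agree, \<open>x\<close> has not been
  matched before, and \<open>S\<^sup>n x\<close> has not been used before. The latter means that
  \<open>S\<^sup>n\<^sup>-\<^sup>m x\<close>, the only point which \<open>S\<^sup>m\<close> sends to \<open>S\<^sup>n x\<close>, was not matched at stage \<open>m\<close>.\<close>

fun matched :: "('a \<Rightarrow> 'a) \<Rightarrow> ('a \<Rightarrow> 'b) \<Rightarrow> ('a \<Rightarrow> 'b) \<Rightarrow> nat \<Rightarrow> 'a \<Rightarrow> bool" where
  "matched S a g n x \<longleftrightarrow> a x = g ((S ^^ n) x) \<and>
    (\<forall>m\<in>{..<n}. \<not> matched S a g m x \<and> \<not> matched S a g m ((S ^^ (n - m)) x))"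

declare matched.simps [simp del]

context mixing_system
begin

text \<open>Here \<open>k'\<close> records, at the target, which power was used. It makes the map invertible, with inverse
  again piecewise a power, and lets the measure be compared piece by piece.\<close>

lemma aut_of_powers:
  assumes k[measurable]: "k \<in> M \<rightarrow>\<^sub>M count_space UNIV" and k'[measurable]: "k' \<in> M \<rightarrow>\<^sub>M count_space UNIV"
    and kk': "\<And>x. x \<in> space M \<Longrightarrow> k' ((S ^^ k x) x) = k x"
    and k'k: "\<And>y. y \<in> space M \<Longrightarrow> k ((R ^^ k' y) y) = k' y"
  shows "(\<lambda>x. (S ^^ k x) x) \<in> auts M"
proof (rule autsI[where R = "\<lambda>y. (R ^^ k' y) y"])
  show Q[measurable]: "(\<lambda>x. (S ^^ k x) x) \<in> M \<rightarrow>\<^sub>M M"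
    by (rule measurable_compose_countable[where f = "\<lambda>n. S ^^ n"]) auto
  show "(\<lambda>y. (R ^^ k' y) y) \<in> M \<rightarrow>\<^sub>M M"
    by (rule measurable_compose_countable[where f = "\<lambda>n. R ^^ n"]) auto
  show "(R ^^ k' ((S ^^ k x) x)) ((S ^^ k x) x) = x" if "x \<in> space M" for x
    using that by (simp add: kk' inv_funpow_cancel(1)[OF S_auts])
  show "(S ^^ k ((R ^^ k' x) x)) ((R ^^ k' x) x) = x" if "x \<in> space M" for x
    using that by (simp add: k'k inv_funpow_cancel(2)[OF S_auts])
  show "distr M M (\<lambda>x. (S ^^ k x) x) = M"
  proof (rule measure_eqI)
    fix A assume "A \<in> sets (distr M M (\<lambda>x. (S ^^ k x) x))"
    then have A[measurable]: "A \<in> sets M" by simp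
    have iff: "k' ((S ^^ n) x) = n \<longleftrightarrow> k x = n" if x: "x \<in> space M" for x n
    proof
      assume "k x = n" then show "k' ((S ^^ n) x) = n" using kk'[OF x] by simp
    next
      assume "k' ((S ^^ n) x) = n"
      then show "k x = n" using k'k[OF S_space[OF x], of n] inv_funpow_cancel(1)[OF S_auts x] by simp
    qed
    have piece: "\<P>(x in M. k x = n \<and> (S ^^ n) x \<in> A) = \<P>(y in M. k' y = n \<and> y \<in> A)" for n
    proof -
      have "\<P>(x in M. k x = n \<and> (S ^^ n) x \<in> A) = \<P>(x in M. k' ((S ^^ n) x) = n \<and> (S ^^ n) x \<in> A)"
        by (intro arg_cong[where f = prob] Collect_cong) (auto simp: iff)
      also have "\<dots> = \<P>(y in M. k' y = n \<and> y \<in> A)" by (rule prob_S) measurable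
      finally show ?thesis .
    qed
    have "(\<lambda>n. prob {x \<in> space M. k x = n \<and> (S ^^ n) x \<in> A}) sums prob (\<Union>n. {x \<in> space M. k x = n \<and> (S ^^ n) x \<in> A})"
      by (rule finite_measure_UNION) (auto simp: disjoint_family_on_def)
    moreover have "(\<lambda>n. prob {y \<in> space M. k' y = n \<and> y \<in> A}) sums prob (\<Union>n. {y \<in> space M. k' y = n \<and> y \<in> A})"
      by (rule finite_measure_UNION) (auto simp: disjoint_family_on_def)
    ultimately have "prob (\<Union>n. {x \<in> space M. k x = n \<and> (S ^^ n) x \<in> A}) = prob (\<Union>n. {y \<in> space M. k' y = n \<and> y \<in> A})"
      unfolding piece by (rule sums_unique2)
    moreover have "(\<Union>n. {x \<in> space M. k x = n \<and> (S ^^ n) x \<in> A}) = (\<lambda>x. (S ^^ k x) x) -` A \<inter> space M" by auto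
    moreover have "(\<Union>n. {y \<in> space M. k' y = n \<and> y \<in> A}) = A" using sets.sets_into_space[OF A] by auto
    ultimately show "emeasure (distr M M (\<lambda>x. (S ^^ k x) x)) A = emeasure M A"
      by (simp add: emeasure_distr emeasure_eq_measure)
  qed simp
qed

lemma matched_measurable:
  assumes [measurable]: "a \<in> M \<rightarrow>\<^sub>M count_space UNIV" "g \<in> M \<rightarrow>\<^sub>M count_space UNIV"
    and I: "finite I" "range a \<subseteq> I"
  shows "Measurable.pred M (matched S a g n)"
proof (induction n rule: less_induct)
  case (less n)
  have [measurable]: "Measurable.pred M (\<lambda>x. \<forall>m\<in>{..<n}. \<not> matched S a g m x \<and> \<not> matched S a g m ((S ^^ (n - m)) x))"
  proof (intro pred_intros_finite finite_lessThan)
    fix m assume "m \<in> {..<n}"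
    then have [measurable]: "Measurable.pred M (matched S a g m)" using less by simp
    show "Measurable.pred M (\<lambda>x. \<not> matched S a g m x \<and> \<not> matched S a g m ((S ^^ (n - m)) x))"
      by measurable
  qed
  have "Measurable.pred M (\<lambda>x. \<exists>i\<in>I. a x = i \<and> g ((S ^^ n) x) = i)"
    by (intro pred_intros_finite I) measurable
  also have "(\<lambda>x. \<exists>i\<in>I. a x = i \<and> g ((S ^^ n) x) = i) = (\<lambda>x. a x = g ((S ^^ n) x))"
    using I by fastforce
  finally have [measurable]: "Measurable.pred M (\<lambda>x. a x = g ((S ^^ n) x))" .
  have "matched S a g n = (\<lambda>x. a x = g ((S ^^ n) x) \<and>
    (\<forall>m\<in>{..<n}. \<not> matched S a g m x \<and> \<not> matched S a g m ((S ^^ (n - m)) x)))"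
    by (rule ext) (rule matched.simps)
  then show ?case by simp
qed

text \<open>Within one label value, the matched points and their targets have equal measure, hence so have
  the unmatched points \<open>U\<close> and the unused targets \<open>Y\<close>. No \<open>S\<^sup>n\<close> takes a point of \<open>U\<close> into \<open>Y\<close>,
  since the pair would have been matched; by mixing the product of the two measures is zero,
  so both are null. The matching moves points along orbits of \<open>S\<close>, so it restricts to a
  bijection of the invariant set \<open>G\<close> of points whose orbits avoid \<open>U\<close> and \<open>Y\<close>; outside \<open>G\<close> the
  identity completes it to a bijection of the whole space.\<close>

lemma ex_aut_transporting_label:
  assumes a[measurable]: "a \<in> M \<rightarrow>\<^sub>M count_space UNIV" and g[measurable]: "g \<in> M \<rightarrow>\<^sub>M count_space UNIV"
    and I: "finite I" "range a \<subseteq> I" "range g \<subseteq> I"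
    and eq: "\<And>i. i \<in> I \<Longrightarrow> prob (fiber M a i) = prob (fiber M g i)"
  shows "\<exists>Q\<in>auts M. AE x in M. g (Q x) = a x"
proof -
  let ?m = "matched S a g"
  have mm[measurable]: "Measurable.pred M (?m n)" for n by (rule matched_measurable[OF a g I(1,2)])
  have m_less: False if "?m n x" "m < n" "?m m x \<or> ?m m ((S ^^ (n - m)) x)" for m n x
    using that matched.simps[of S a g n x] by auto
  have inj_dom: "m = n" if "?m m x" "?m n x" for m n x
    using m_less[of m x n] m_less[of n x m] that by (cases m n rule: linorder_cases) auto
  have inj_ran: "m = n" if y: "y \<in> space M" and "?m m ((R ^^ m) y)" "?m n ((R ^^ n) y)" for m n y
  proof -
    have "\<not> m < n" if "?m m ((R ^^ m) y)" "?m n ((R ^^ n) y)" for m n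
    proof
      assume mn: "m < n"
      have "(S ^^ (n - m)) ((R ^^ n) y) = (S ^^ (n - m)) ((R ^^ (n - m)) ((R ^^ m) y))"
        using mn by (metis comp_apply funpow_add le_add_diff_inverse2 less_imp_le)
      also have "\<dots> = (R ^^ m) y" by (rule inv_funpow_cancel(2)[OF S_auts R_space[OF y]])
      finally show False using m_less[OF that(2) mn] that(1) by simp
    qed
    then show ?thesis using that by (metis linorder_neqE_nat)
  qed
  define U where "U x \<longleftrightarrow> (\<forall>n. \<not> ?m n x)" for x
  define Y where "Y y \<longleftrightarrow> (\<forall>n. \<not> ?m n ((R ^^ n) y))" for y
  have UM[measurable]: "Measurable.pred M U" unfolding U_def by measurable
  have YM[measurable]: "Measurable.pred M Y" unfolding Y_def by measurable
  have null: "\<P>(x in M. U x \<and> a x = i) = 0 \<and> \<P>(y in M. Y y \<and> g y = i) = 0" if i: "i \<in> I" for i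
  proof -
    have "(\<lambda>n. prob {x \<in> space M. ?m n x \<and> a x = i}) sums prob (\<Union>n. {x \<in> space M. ?m n x \<and> a x = i})"
      by (rule finite_measure_UNION) (use inj_dom in \<open>auto simp: disjoint_family_on_def\<close>)
    moreover have "(\<lambda>n. prob {y \<in> space M. ?m n ((R ^^ n) y) \<and> g y = i}) sums prob (\<Union>n. {y \<in> space M. ?m n ((R ^^ n) y) \<and> g y = i})"
      by (rule finite_measure_UNION) (use inj_ran in \<open>auto simp: disjoint_family_on_def\<close>)
    moreover have "prob {x \<in> space M. ?m n x \<and> a x = i} = prob {y \<in> space M. ?m n ((R ^^ n) y) \<and> g y = i}" for n
    proof -
      have "prob {y \<in> space M. ?m n ((R ^^ n) y) \<and> g y = i} =
        \<P>(x in M. ?m n ((R ^^ n) ((S ^^ n) x)) \<and> g ((S ^^ n) x) = i)"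
        by (rule prob_S[symmetric]) measurable
      also have "\<dots> = \<P>(x in M. ?m n x \<and> a x = i)"
        by (intro arg_cong[where f = prob] Collect_cong)
          (use matched.simps[of S a g n] in \<open>auto simp: inv_funpow_cancel(1)[OF S_auts]\<close>)
      finally show ?thesis ..
    qed
    ultimately have U1: "prob (\<Union>n. {x \<in> space M. ?m n x \<and> a x = i}) = prob (\<Union>n. {y \<in> space M. ?m n ((R ^^ n) y) \<and> g y = i})"
      by (simp add: sums_unique2)
    have "{x \<in> space M. U x \<and> a x = i} = fiber M a i - (\<Union>n. {x \<in> space M. ?m n x \<and> a x = i})"
      by (auto simp: U_def fiber_def)
    moreover have "prob (fiber M a i - (\<Union>n. {x \<in> space M. ?m n x \<and> a x = i}))
      = prob (fiber M a i) - prob (\<Union>n. {x \<in> space M. ?m n x \<and> a x = i})"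
      by (rule finite_measure_Diff) (auto simp: fiber_def)
    moreover have "{y \<in> space M. Y y \<and> g y = i} = fiber M g i - (\<Union>n. {y \<in> space M. ?m n ((R ^^ n) y) \<and> g y = i})"
      by (auto simp: Y_def fiber_def)
    moreover have "prob (fiber M g i - (\<Union>n. {y \<in> space M. ?m n ((R ^^ n) y) \<and> g y = i}))
      = prob (fiber M g i) - prob (\<Union>n. {y \<in> space M. ?m n ((R ^^ n) y) \<and> g y = i})"
      by (rule finite_measure_Diff) (auto simp: fiber_def)
    ultimately have same: "\<P>(x in M. U x \<and> a x = i) = \<P>(y in M. Y y \<and> g y = i)"
      using U1 eq[OF i] by simp
    have "corr M S n {x \<in> space M. U x \<and> a x = i} {y \<in> space M. Y y \<and> g y = i} = 0" for n
    proof -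
      have False if x: "x \<in> space M" "U x" "a x = i" and y: "Y ((S ^^ n) x)" "g ((S ^^ n) x) = i" for x
      proof -
        have "\<not> ?m n x" using x by (simp add: U_def)
        then obtain m where m: "m < n" "?m m x \<or> ?m m ((S ^^ (n - m)) x)"
          using x y matched.simps[of S a g n x] by auto
        then have "?m m ((R ^^ m) ((S ^^ n) x))"
          using x inv_funpow_cancel_le(1)[OF S_auts x(1), of m n] by (auto simp: U_def)
        then show False using y by (auto simp: Y_def)
      qed
      then have "{x \<in> space M. x \<in> {x \<in> space M. U x \<and> a x = i} \<and> (S ^^ n) x \<in> {y \<in> space M. Y y \<and> g y = i}} = {}"
        by blast
      then show ?thesis unfolding corr_def by (simp only: measure_empty)
    qed
    moreover have "(\<lambda>n. corr M S n {x \<in> space M. U x \<and> a x = i} {y \<in> space M. Y y \<and> g y = i})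
      \<longlonglongrightarrow> \<P>(x in M. U x \<and> a x = i) * \<P>(y in M. Y y \<and> g y = i)"
      by (rule mixing_tendsto) measurable
    ultimately have "0 = \<P>(x in M. U x \<and> a x = i) * \<P>(y in M. Y y \<and> g y = i)"
      by (simp only: LIMSEQ_const_iff)
    then show ?thesis using same by simp
  qed
  have "\<P>(x in M. U x) = 0" "\<P>(y in M. Y y) = 0"
    using measure_sum_values[OF UM a I(1)] measure_sum_values[OF YM g I(1)] I null by auto
  then have aeU: "AE x in M. \<not> U x" and aeY: "AE y in M. \<not> Y y"
    by (auto simp: prob_eq_0)
  define G where "G x \<longleftrightarrow> (\<forall>n. \<not> U ((S ^^ n) x) \<and> \<not> Y ((S ^^ n) x) \<and> \<not> U ((R ^^ n) x) \<and> \<not> Y ((R ^^ n) x))" for x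
  have GM[measurable]: "Measurable.pred M G" unfolding G_def by measurable
  have aeG: "AE x in M. G x"
    unfolding G_def AE_all_countable
    by (intro allI AE_conjI AE_auts[OF auts_funpow] S_auts R_auts aeU aeY)
  have GS: "G ((S ^^ n) x)" if "G x" "x \<in> space M" for n x
  proof -
    have "(S ^^ m) ((S ^^ n) x) = (S ^^ (m + n)) x" for m by (simp add: funpow_add)
    moreover have "(R ^^ m) ((S ^^ n) x) = (if m \<le> n then (S ^^ (n - m)) x else (R ^^ (m - n)) x)" for m
      using inv_funpow_cancel_le[OF S_auts that(2)] by auto
    ultimately show ?thesis using that(1) by (auto simp: G_def)
  qed
  have GR: "G ((R ^^ n) x)" if "G x" "x \<in> space M" for n x
  proof -
    have "(R ^^ m) ((R ^^ n) x) = (R ^^ (m + n)) x" for m by (simp add: funpow_add)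
    moreover have "(S ^^ m) ((R ^^ n) x) = (if m \<le> n then (R ^^ (n - m)) x else (S ^^ (m - n)) x)" for m
    proof (cases "m \<le> n")
      case True
      then have "(R ^^ n) x = (R ^^ m) ((R ^^ (n - m)) x)" by (metis comp_apply funpow_add le_add_diff_inverse)
      then show ?thesis using True inv_funpow_cancel(2)[OF S_auts R_space[OF that(2)]] by simp
    next
      case False
      then have "(S ^^ m) ((R ^^ n) x) = (S ^^ (m - n)) ((S ^^ n) ((R ^^ n) x))"
        by (metis comp_apply funpow_add le_add_diff_inverse2 nat_le_linear)
      then show ?thesis using False inv_funpow_cancel(2)[OF S_auts that(2)] by simp
    qed
    ultimately show ?thesis using that(1) by (auto simp: G_def)
  qed
  define k where "k x = (if G x then LEAST n. ?m n x else 0)" for x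
  define k' where "k' y = (if G y then LEAST n. ?m n ((R ^^ n) y) else 0)" for y
  have [measurable]: "k \<in> M \<rightarrow>\<^sub>M count_space UNIV" unfolding k_def by measurable
  have [measurable]: "k' \<in> M \<rightarrow>\<^sub>M count_space UNIV" unfolding k'_def by measurable
  have k_eq: "k x = n" if "G x" "?m n x" for x n
    using that inj_dom LeastI[of "\<lambda>n. ?m n x" n] by (auto simp: k_def)
  have k'_eq: "k' y = n" if "G y" "y \<in> space M" "?m n ((R ^^ n) y)" for y n
    using that inj_ran LeastI[of "\<lambda>n. ?m n ((R ^^ n) y)" n] by (auto simp: k'_def)
  have k_ex: "?m (k x) x" if "G x" for x
  proof -
    have "\<exists>n. ?m n x" using that G_def[of x] U_def by (metis funpow_0)
    then show ?thesis using k_eq[OF that] by auto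
  qed
  have k'_ex: "?m (k' y) ((R ^^ k' y) y)" if "G y" "y \<in> space M" for y
  proof -
    have "\<exists>n. ?m n ((R ^^ n) y)" using that G_def[of y] Y_def by (metis funpow_0)
    then show ?thesis using k'_eq[OF that] by auto
  qed
  have "(\<lambda>x. (S ^^ k x) x) \<in> auts M"
  proof (rule aut_of_powers)
    fix x assume x: "x \<in> space M"
    show "k' ((S ^^ k x) x) = k x"
    proof (cases "G x")
      case True
      then show ?thesis
        using x by (intro k'_eq GS S_space) (auto simp: inv_funpow_cancel(1)[OF S_auts] k_ex)
    qed (simp add: k_def k'_def)
    show "k ((R ^^ k' x) x) = k' x"
    proof (cases "G x")
      case True
      then show ?thesis using x by (intro k_eq GR k'_ex)
    qed (simp add: k_def k'_def)
  qed measurable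
  moreover have "AE x in M. g ((S ^^ k x) x) = a x"
    using aeG
  proof eventually_elim
    case (elim x)
    show ?case using k_ex[OF elim] matched.simps[of S a g "k x" x] by simp
  qed
  ultimately show ?thesis by (intro bexI[of _ "\<lambda>x. (S ^^ k x) x"])
qed

text \<open>Keep as much of each level set of \<open>f\<close> as the target measure allows, and distribute what is left
  over among the values with a deficit.\<close>

lemma ex_label_with_exact_distribution:
  assumes a[measurable]: "a \<in> M \<rightarrow>\<^sub>M count_space UNIV" and f[measurable]: "f \<in> M \<rightarrow>\<^sub>M count_space UNIV"
    and I: "finite I" "range a \<subseteq> I" "range f \<subseteq> I"
    and close: "\<And>i. i \<in> I \<Longrightarrow> \<bar>prob (fiber M f i) - prob (fiber M a i)\<bar> \<le> d"
  shows "\<exists>g. g \<in> M \<rightarrow>\<^sub>M count_space UNIV \<and> range g \<subseteq> I \<and>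
    (\<forall>i\<in>I. prob (fiber M g i) = prob (fiber M a i)) \<and> \<P>(x in M. f x \<noteq> g x) \<le> real (card I) * d"
proof -
  have afib[measurable]: "fiber M a i \<in> sets M" and ffib[measurable]: "fiber M f i \<in> sets M" for i
    unfolding fiber_def by measurable
  have "\<forall>i. \<exists>C\<in>sets M. C \<subseteq> fiber M f i \<and> prob C = min (prob (fiber M f i)) (prob (fiber M a i))"
    by (auto intro!: divisible)
  from choice[OF this[unfolded Bex_def]] obtain C where C_all:
    "\<forall>i. C i \<in> sets M \<and> C i \<subseteq> fiber M f i \<and> prob (C i) = min (prob (fiber M f i)) (prob (fiber M a i))" ..
  then have C[measurable]: "\<And>i. C i \<in> sets M" and Cf: "\<And>i. C i \<subseteq> fiber M f i"
    and pC: "\<And>i. prob (C i) = min (prob (fiber M f i)) (prob (fiber M a i))" by auto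
  have disj: "disjoint_family_on C I" using Cf unfolding disjoint_family_on_def fiber_def by blast
  define Z where "Z = space M - (\<Union>i\<in>I. C i)"
  have UC[measurable]: "(\<Union>i\<in>I. C i) \<in> sets M" by (intro sets.finite_UN I C)
  have Z[measurable]: "Z \<in> sets M" unfolding Z_def by measurable
  have "prob Z = 1 - (\<Sum>i\<in>I. prob (C i))"
  proof -
    have "prob (\<Union>i\<in>I. C i) = (\<Sum>i\<in>I. prob (C i))"
      by (rule finite_measure_finite_Union) (use I disj C in auto)
    then show ?thesis unfolding Z_def prob_compl[OF UC] by simp
  qed
  moreover have "(\<Sum>i\<in>I. prob (fiber M a i)) = 1"
    using measure_sum_values[of "\<lambda>_. True" a I] I prob_space by (auto simp: fiber_def)
  ultimately have pZ: "prob Z = (\<Sum>i\<in>I. prob (fiber M a i) - prob (C i))" by (simp add: sum_subtractf)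
  have ne: "I \<noteq> {}" using I by auto
  have "\<exists>h. h \<in> M \<rightarrow>\<^sub>M count_space UNIV \<and> range h \<subseteq> I \<and>
    (\<forall>i\<in>I. prob {x \<in> space M. x \<in> Z \<and> h x = i} = prob (fiber M a i) - prob (C i))"
    by (rule split_with_weights) (use I ne pZ pC in auto)
  then obtain h where h[measurable]: "h \<in> M \<rightarrow>\<^sub>M count_space UNIV" and hr: "range h \<subseteq> I"
    and ph: "\<And>i. i \<in> I \<Longrightarrow> prob {x \<in> space M. x \<in> Z \<and> h x = i} = prob (fiber M a i) - prob (C i)"
    by blast
  define g where "g x = (if x \<in> Z then h x else f x)" for x
  have [measurable]: "g \<in> M \<rightarrow>\<^sub>M count_space UNIV" unfolding g_def by measurable
  have gr: "range g \<subseteq> I" using hr I by (auto simp: g_def)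
  have "prob (fiber M g i) = prob (fiber M a i)" if i: "i \<in> I" for i
  proof -
    have "x \<in> C i" if "x \<in> space M" "x \<notin> Z" "f x = i" for x
    proof -
      obtain j where "x \<in> C j" using \<open>x \<notin> Z\<close> \<open>x \<in> space M\<close> by (auto simp: Z_def)
      moreover have "j = i" using Cf[of j] \<open>x \<in> C j\<close> \<open>f x = i\<close> by (auto simp: fiber_def)
      ultimately show ?thesis by simp
    qed
    then have "fiber M g i = C i \<union> {x \<in> space M. x \<in> Z \<and> h x = i}"
      using Cf[of i] i by (auto simp: fiber_def g_def Z_def)
    moreover have "prob (C i \<union> {x \<in> space M. x \<in> Z \<and> h x = i}) = prob (C i) + prob {x \<in> space M. x \<in> Z \<and> h x = i}"
    proof (rule finite_measure_Union[OF C])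
      show "{x \<in> space M. x \<in> Z \<and> h x = i} \<in> sets M" by measurable
    qed (use i in \<open>auto simp: Z_def\<close>)
    ultimately show ?thesis using ph[OF i] by simp
  qed
  moreover have "\<P>(x in M. f x \<noteq> g x) \<le> real (card I) * d"
  proof -
    have "\<P>(x in M. f x \<noteq> g x) \<le> prob Z"
      by (rule finite_measure_mono) (auto simp: g_def)
    also have "\<dots> \<le> (\<Sum>i\<in>I. d)"
      unfolding pZ pC by (intro sum_mono) (use close in \<open>fastforce simp: min_def abs_le_iff\<close>)
    finally show ?thesis by simp
  qed
  ultimately show ?thesis using gr by (intro exI[of _ g]) auto
qed

lemma corr_label_perturb:
  assumes [measurable]: "f \<in> M \<rightarrow>\<^sub>M count_space UNIV" "g \<in> M \<rightarrow>\<^sub>M count_space UNIV"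
    and I: "finite I" "range f \<subseteq> I"
  shows "\<bar>corr M S n (fiber M f i) (fiber M f j) - corr M S n (fiber M g i) (fiber M g j)\<bar> \<le> 2 * \<P>(x in M. f x \<noteq> g x)"
proof -
  have "Measurable.pred M (\<lambda>x. \<exists>i\<in>I. f x = i \<and> g x \<noteq> i)"
    by (intro pred_intros_finite I) measurable
  also have "(\<lambda>x. \<exists>i\<in>I. f x = i \<and> g x \<noteq> i) = (\<lambda>x. f x \<noteq> g x)" using I by fastforce
  finally have N[measurable]: "Measurable.pred M (\<lambda>x. f x \<noteq> g x)" .
  have one: "corr M S n (fiber M u i) (fiber M u j) \<le> corr M S n (fiber M v i) (fiber M v j) + 2 * \<P>(x in M. f x \<noteq> g x)"
    if [measurable]: "u \<in> M \<rightarrow>\<^sub>M count_space UNIV" "v \<in> M \<rightarrow>\<^sub>M count_space UNIV"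
      and uv: "\<And>x. u x \<noteq> v x \<Longrightarrow> f x \<noteq> g x" for u v
  proof -
    have uv': "v x = u x" if "f x = g x" for x using uv[of x] that by metis
    have e: "corr M S n (fiber M w i) (fiber M w j) = \<P>(x in M. w x = i \<and> w ((S ^^ n) x) = j)" for w
      unfolding corr_def fiber_def by (intro arg_cong[where f = prob]) (use S_space in auto)
    have "\<P>(x in M. u x = i \<and> u ((S ^^ n) x) = j) \<le>
      prob ({x \<in> space M. v x = i \<and> v ((S ^^ n) x) = j} \<union> ({x \<in> space M. f x \<noteq> g x} \<union> {x \<in> space M. f ((S ^^ n) x) \<noteq> g ((S ^^ n) x)}))"
      by (rule finite_measure_mono) (use uv' in \<open>auto simp: measurable_compose[OF S_measurable N]\<close>)
    also have "\<dots> \<le> prob {x \<in> space M. v x = i \<and> v ((S ^^ n) x) = j} + (\<P>(x in M. f x \<noteq> g x) + \<P>(x in M. f ((S ^^ n) x) \<noteq> g ((S ^^ n) x)))"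
      by (intro order_trans[OF measure_Un_le] add_left_mono measure_Un_le) (auto intro: measurable_compose[OF S_measurable N, unfolded o_def])
    also have "\<P>(x in M. f ((S ^^ n) x) \<noteq> g ((S ^^ n) x)) = \<P>(x in M. f x \<noteq> g x)" by (rule prob_S[OF N])
    finally show ?thesis unfolding e by simp
  qed
  show ?thesis using one[of f g] one[of g f] by (auto simp: abs_le_iff)
qed

end

section \<open>Conjugates and density\<close>

lemma conj_funpow:
  assumes Q: "Q \<in> auts M" and S: "S \<in> auts M" and x: "x \<in> space M"
  shows "((inv_into (space M) Q \<circ> S \<circ> Q) ^^ n) x = inv_into (space M) Q ((S ^^ n) (Q x))"
proof (induction n)
  case 0
  then show ?case using auts_inv_f[OF Q x] by simp
next
  case (Suc n)
  have "(S ^^ n) (Q x) \<in> space M"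
    using auts_space[OF auts_funpow[OF S] auts_space[OF Q x]] .
  with Suc show ?case by (simp add: auts_f_inv[OF Q])
qed

lemma conj_auts:
  assumes "Q \<in> auts M" "S \<in> auts M"
  shows "inv_into (space M) Q \<circ> S \<circ> Q \<in> auts M"
  using assms by (intro auts_comp auts_inv)

lemma conj_mixing:
  assumes Q: "Q \<in> auts M" and S: "S \<in> mixing_maps M"
  shows "inv_into (space M) Q \<circ> S \<circ> Q \<in> mixing_maps M"
proof -
  have S_auts: "S \<in> auts M" using S by (simp add: mixing_maps_def)
  let ?Q' = "inv_into (space M) Q"
  have [measurable]: "?Q' \<in> M \<rightarrow>\<^sub>M M" "S ^^ n \<in> M \<rightarrow>\<^sub>M M" for n
    using auts_measurable[OF auts_inv[OF Q]] measurable_auts_funpow[OF S_auts] by auto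
  define P where "P A = {x \<in> space M. ?Q' x \<in> A}" for A
  have P: "P A \<in> sets M" "measure M (P A) = measure M A" if [measurable]: "A \<in> sets M" for A
  proof -
    show "P A \<in> sets M" unfolding P_def by measurable
    show "measure M (P A) = measure M A"
      unfolding P_def by (rule measure_auts_vimage[OF auts_inv[OF Q] that])
  qed
  have corr_eq: "corr M (?Q' \<circ> S \<circ> Q) n A B = corr M S n (P A) (P B)"
    if [measurable]: "A \<in> sets M" "B \<in> sets M" for n A B
  proof -
    have "corr M (?Q' \<circ> S \<circ> Q) n A B = \<P>(x in M. ?Q' (Q x) \<in> A \<and> ?Q' ((S ^^ n) (Q x)) \<in> B)"
      unfolding corr_def
      by (intro arg_cong[where f = "measure M"] Collect_cong)
        (auto simp: conj_funpow[OF Q S_auts] auts_inv_f[OF Q])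
    also have "\<dots> = \<P>(x in M. ?Q' x \<in> A \<and> ?Q' ((S ^^ n) x) \<in> B)"
      by (rule prob_auts[OF Q]) measurable
    also have "\<dots> = corr M S n (P A) (P B)"
      unfolding corr_def P_def
      by (intro arg_cong[where f = "measure M"] Collect_cong) (use auts_space[OF auts_funpow[OF S_auts]] in auto)
    finally show ?thesis .
  qed
  have "(\<lambda>n. corr M (?Q' \<circ> S \<circ> Q) n A B) \<longlonglongrightarrow> measure M A * measure M B"
    if AB: "A \<in> sets M" "B \<in> sets M" for A B
  proof -
    have "(\<lambda>n. corr M S n (P A) (P B)) \<longlonglongrightarrow> measure M (P A) * measure M (P B)"
      using S P(1)[OF AB(1)] P(1)[OF AB(2)] unfolding mixing_iff_corr by blast
    then show ?thesis by (simp only: corr_eq[OF AB] P(2)[OF AB(1)] P(2)[OF AB(2)])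
  qed
  then show ?thesis unfolding mixing_iff_corr using conj_auts[OF Q S_auts] by blast
qed

text \<open>The atoms of the algebra generated by \<open>q\<close> are the level sets of \<open>x \<mapsto> {C \<in> q. x \<in> C}\<close>.\<close>

lemma (in finite_measure) corr_eq_sum_label:
  assumes T: "T \<in> auts M" and q: "finite q" "q \<subseteq> sets M" and AB: "A \<in> q" "B \<in> q"
    and a: "a = (\<lambda>x. {C\<in>q. x \<in> C})" "a \<in> M \<rightarrow>\<^sub>M count_space UNIV"
  shows "corr M T n A B =
    (\<Sum>i\<in>{i\<in>Pow q. A \<in> i}. \<Sum>j\<in>{j\<in>Pow q. B \<in> j}. corr M T n (fiber M a i) (fiber M a j))"
proof -
  have [measurable]: "A \<in> sets M" "B \<in> sets M" using q AB by auto
  have fm: "fiber M a i \<in> sets M" for i using a(2) unfolding fiber_def by measurable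
  have cap: "C \<inter> fiber M a i = fiber M a i" if "C \<in> i" for C i
    using that a(1) by (auto simp: fiber_def)
  have "corr M T n A B = (\<Sum>i\<in>{i\<in>Pow q. A \<in> i}. corr M T n (A \<inter> fiber M a i) B)"
    by (rule corr_split_left[OF T _ _ a(2)]) (use q AB a(1) in auto)
  also have "\<dots> = (\<Sum>i\<in>{i\<in>Pow q. A \<in> i}. corr M T n (fiber M a i) B)"
    by (intro sum.cong refl) (simp add: cap)
  also have "\<dots> = (\<Sum>i\<in>{i\<in>Pow q. A \<in> i}. \<Sum>j\<in>{j\<in>Pow q. B \<in> j}. corr M T n (fiber M a i) (B \<inter> fiber M a j))"
    by (intro sum.cong refl corr_split_right[OF T fm _ a(2)]) (use q AB a(1) in auto)
  also have "\<dots> = (\<Sum>i\<in>{i\<in>Pow q. A \<in> i}. \<Sum>j\<in>{j\<in>Pow q. B \<in> j}. corr M T n (fiber M a i) (fiber M a j))"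
    by (intro sum.cong refl) (simp add: cap)
  finally show ?thesis .
qed

context mixing_system
begin

text \<open>The conjugate sees the label \<open>a\<close> as \<open>S\<close> sees the label \<open>g\<close>.\<close>

lemma conj_corr_label:
  assumes Q: "Q \<in> auts M" and a[measurable]: "a \<in> M \<rightarrow>\<^sub>M count_space UNIV"
    and g[measurable]: "g \<in> M \<rightarrow>\<^sub>M count_space UNIV" and ae: "AE x in M. g (Q x) = a x"
  shows "corr M (inv_into (space M) Q \<circ> S \<circ> Q) n (fiber M a i) (fiber M a j) = corr M S n (fiber M g i) (fiber M g j)"
proof -
  let ?C = "inv_into (space M) Q \<circ> S \<circ> Q"
  have C: "?C \<in> auts M" by (rule conj_auts[OF Q S_auts])
  have [measurable]: "Q \<in> M \<rightarrow>\<^sub>M M" "?C ^^ n \<in> M \<rightarrow>\<^sub>M M"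
    by (rule auts_measurable[OF Q], rule measurable_auts_funpow[OF C])
  have QC: "Q ((?C ^^ n) x) = (S ^^ n) (Q x)" if "x \<in> space M" for x
    unfolding conj_funpow[OF Q S_auts that]
    by (intro auts_f_inv[OF Q] S_space auts_space[OF Q] that)
  have "corr M ?C n (fiber M a i) (fiber M a j) = \<P>(x in M. a x = i \<and> a ((?C ^^ n) x) = j)"
    unfolding corr_def fiber_def
    by (intro arg_cong[where f = prob] Collect_cong) (use auts_space[OF auts_funpow[OF C]] in auto)
  also have "\<dots> = \<P>(x in M. g (Q x) = i \<and> g ((S ^^ n) (Q x)) = j)"
  proof (rule measure_eq_AE)
    show "AE x in M. x \<in> {x \<in> space M. a x = i \<and> a ((?C ^^ n) x) = j} \<longleftrightarrow>
      x \<in> {x \<in> space M. g (Q x) = i \<and> g ((S ^^ n) (Q x)) = j}"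
      using ae AE_auts[OF auts_funpow[OF C, of n] ae] AE_space
      by eventually_elim (auto simp: QC)
  qed measurable
  also have "\<dots> = \<P>(x in M. g x = i \<and> g ((S ^^ n) x) = j)"
    by (rule prob_auts[OF Q]) measurable
  also have "\<dots> = corr M S n (fiber M g i) (fiber M g j)"
    unfolding corr_def fiber_def by (intro arg_cong[where f = prob] Collect_cong) (use S_space in auto)
  finally show ?thesis .
qed

lemma ex_conjugate_in_leash_nbhd:
  assumes T: "T \<in> mixing_maps M" and q: "finite q" "q \<subseteq> sets M" and d: "d > 0"
  shows "\<exists>Q\<in>auts M. mod0 M (inv_into (space M) Q \<circ> S \<circ> Q) \<in> leash_nbhd M T q d"
proof -
  have T_auts: "T \<in> auts M" using T by (simp add: mixing_maps_def)
  define I where "I = Pow q"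
  define c where "c = real (card I)"
  have I: "finite I" "I \<noteq> {}" using q by (auto simp: I_def)
  then have c: "1 \<le> c" by (simp add: c_def Suc_leI card_gt_0_iff)
  define a where "a = (\<lambda>x. {C\<in>q. x \<in> C})"
  have ar: "range a \<subseteq> I" by (auto simp: a_def I_def)
  have a[measurable]: "a \<in> M \<rightarrow>\<^sub>M count_space UNIV"
  proof (rule measurable_finite_range[OF I(1) ar])
    fix i assume i: "i \<in> I"
    have "{x \<in> space M. a x = i} = {x \<in> space M. \<forall>C\<in>q. x \<in> C \<longleftrightarrow> C \<in> i}"
      using i by (auto simp: a_def I_def)
    also have "\<dots> \<in> sets M" using q by (intro sets.sets_Collect_finite_All) auto
    finally show "{x \<in> space M. a x = i} \<in> sets M" .
  qed
  \<comment> \<open>An atom correlation will be off by at most \<open>3 c r\<close>, and a correlation of members of \<open>q\<close> sums at most \<open>c\<^sup>2\<close> of them.\<close>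
  define r where "r = d / (8 * c ^ 3)"
  have r: "0 < r" using d c by (simp add: r_def)
  from ex_label_with_close_correlations[OF T a I(1) ar r] obtain f where f': "f \<in> M \<rightarrow>\<^sub>M count_space UNIV \<and> range f \<subseteq> I \<and>
    (\<forall>n. \<forall>i\<in>I. \<forall>j\<in>I. \<bar>corr M S n (fiber M f i) (fiber M f j) - corr M T n (fiber M a i) (fiber M a j)\<bar> \<le> r)" ..
  note f[measurable] = f'[THEN conjunct1] and fr = f'[THEN conjunct2, THEN conjunct1]
    and f_close = f'[THEN conjunct2, THEN conjunct2, rule_format]
  have "\<bar>prob (fiber M f i) - prob (fiber M a i)\<bar> \<le> r" if "i \<in> I" for i
    using f_close[OF that that, of 0] by (simp add: corr_0_fiber)
  from ex_label_with_exact_distribution[OF a f I(1) ar fr this] obtain g where g': "g \<in> M \<rightarrow>\<^sub>M count_space UNIV \<and> range g \<subseteq> I \<and>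
    (\<forall>i\<in>I. prob (fiber M g i) = prob (fiber M a i)) \<and> \<P>(x in M. f x \<noteq> g x) \<le> real (card I) * r" ..
  note g[measurable] = g'[THEN conjunct1] and gr = g'[THEN conjunct2, THEN conjunct1]
    and g_eq = g'[THEN conjunct2, THEN conjunct2, THEN conjunct1, rule_format]
    and fg = g'[THEN conjunct2, THEN conjunct2, THEN conjunct2, folded c_def]
  obtain Q where Q: "Q \<in> auts M" and Qg: "AE x in M. g (Q x) = a x"
    using ex_aut_transporting_label[OF a g I(1) ar gr g_eq[symmetric]] by blast
  let ?C = "inv_into (space M) Q \<circ> S \<circ> Q"
  have C: "?C \<in> mixing_maps M" by (rule conj_mixing[OF Q S_mixing])
  have C_auts: "?C \<in> auts M" by (rule conj_auts[OF Q S_auts])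
  have atom: "\<bar>corr M T n (fiber M a i) (fiber M a j) - corr M ?C n (fiber M a i) (fiber M a j)\<bar> \<le> 3 * c * r"
    if "i \<in> I" "j \<in> I" for n i j
  proof -
    have "\<bar>corr M S n (fiber M f i) (fiber M f j) - corr M S n (fiber M g i) (fiber M g j)\<bar> \<le> 2 * (c * r)"
      using corr_label_perturb[OF f g I(1) fr, of n i j] fg by linarith
    moreover have "r \<le> c * r" using c r by simp
    ultimately show ?thesis
      using f_close[OF that, of n] unfolding conj_corr_label[OF Q a g Qg] by linarith
  qed
  have pair: "\<bar>corr M T n A B - corr M ?C n A B\<bar> < d" if AB: "A \<in> q" "B \<in> q" for n A B
  proof -
    let ?I = "{i\<in>Pow q. A \<in> i}" and ?J = "{j\<in>Pow q. B \<in> j}"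
    have "corr M T n A B - corr M ?C n A B =
      (\<Sum>i\<in>?I. \<Sum>j\<in>?J. corr M T n (fiber M a i) (fiber M a j) - corr M ?C n (fiber M a i) (fiber M a j))"
      unfolding corr_eq_sum_label[OF T_auts q AB a_def a] corr_eq_sum_label[OF C_auts q AB a_def a]
      by (simp only: sum_subtractf)
    then have "\<bar>corr M T n A B - corr M ?C n A B\<bar> \<le>
      (\<Sum>i\<in>?I. \<Sum>j\<in>?J. \<bar>corr M T n (fiber M a i) (fiber M a j) - corr M ?C n (fiber M a i) (fiber M a j)\<bar>)"
      by (auto intro!: order_trans[OF sum_abs] sum_mono)
    also have "\<dots> \<le> (\<Sum>i\<in>?I. \<Sum>j\<in>?J. 3 * c * r)"
      by (intro sum_mono atom) (auto simp: I_def)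
    also have "\<dots> = real (card ?I) * (real (card ?J) * (3 * c * r))" by simp
    also have "\<dots> \<le> c * (c * (3 * c * r))"
      unfolding c_def I_def using q r
      by (intro mult_mono) (auto intro!: card_mono)
    also have "\<dots> = 3 * d / 8" using c by (simp add: r_def power3_eq_cube)
    also have "\<dots> < d" using d by simp
    finally show ?thesis .
  qed
  have "\<bar>measure M (int_iter M T n ` A \<inter> B) - measure M (int_iter M ?C n ` A \<inter> B)\<bar> < d"
    if AB: "A \<in> q" "B \<in> q" for n A B
  proof -
    have s: "A \<in> sets M" "B \<in> sets M" using AB q by auto
    show ?thesis
    proof (cases n rule: int_cases2)
      case (nonneg m)
      then show ?thesis
        using pair[OF AB, of m] by (simp only: corr_eq_measure_image[OF T_auts s] corr_eq_measure_image[OF C_auts s])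
    next
      case (nonpos m)
      then show ?thesis
        using pair[OF AB(2,1), of m]
        by (simp only: measure_int_iter_swap[OF T_auts s] measure_int_iter_swap[OF C_auts s]
          corr_eq_measure_image[OF T_auts s(2,1)] corr_eq_measure_image[OF C_auts s(2,1)])
    qed
  qed
  then have "mod0 M ?C \<in> leash_nbhd M T q d"
    unfolding leash_nbhd_mod0_iff[OF C q(2)] by blast
  with Q show ?thesis by blast
qed

end

theorem theorem1:
  fixes M :: "'a measure" and S :: "'a \<Rightarrow> 'a"
  assumes "standard_nonatomic_prob_space M"
    and "S \<in> mixing_maps M"
  shows "conj_class M S \<subseteq> mixing_space M \<and>
    leash_topology M closure_of conj_class M S = mixing_space M"
proof -
  interpret mixing_system M S
    using standard_nonatomic_imp_nonatomic[OF assms(1)] assms(2)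
    by (simp add: mixing_system_def mixing_system_axioms_def)
  have sub: "conj_class M S \<subseteq> mixing_space M"
    using conj_mixing[OF _ assms(2)] by (auto simp: conj_class_def mixing_space_def)
  moreover have "mixing_space M \<subseteq> leash_topology M closure_of conj_class M S"
  proof
    fix u assume u: "u \<in> mixing_space M"
    then obtain T where T: "T \<in> mixing_maps M" "u = mod0 M T" by (auto simp: mixing_space_def)
    show "u \<in> leash_topology M closure_of conj_class M S"
      unfolding in_closure_of topspace_leash_topology
    proof (intro conjI u allI impI)
      fix W assume W: "u \<in> W \<and> openin (leash_topology M) W"
      then obtain V where V: "V \<in> leash_base M" "u \<in> V" "V \<subseteq> W"
        unfolding openin_leash_topology arbitrary_union_of_alt by blast
      then obtain T0 q e where V0: "V = leash_nbhd M T0 q e" "T0 \<in> mixing_maps M" "finite q" "q \<subseteq> sets M" "e > 0"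
        by (auto simp: leash_base_def)
      obtain d where d: "d > 0" "leash_nbhd M T q d \<subseteq> V"
        using leash_nbhd_margin[OF V0(2) T(1) V0(3-5)] V(2) T(2) V0(1) by auto
      obtain Q where Q: "Q \<in> auts M" "mod0 M (inv_into (space M) Q \<circ> S \<circ> Q) \<in> leash_nbhd M T q d"
        using ex_conjugate_in_leash_nbhd[OF T(1) V0(3,4) d(1)] by blast
      then show "\<exists>y. y \<in> conj_class M S \<and> y \<in> W"
        using d(2) V(3) by (auto simp: conj_class_def)
    qed
  qed
  moreover have "leash_topology M closure_of conj_class M S \<subseteq> mixing_space M"
    using closure_of_subset_topspace[of "leash_topology M"] by (simp add: topspace_leash_topology)
  ultimately show ?thesis by blast
qed

end
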